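(* Let $2\le m<n$, let $g_1,\dots,g_m:\mathbb{R}^n\to\mathbb{R}$ be smooth maps and $c_1,\dots,c_m\in\mathbb{R}$. Let $Y=\{p\in\mathbb{R}^n: g_i(p)=c_i \text{ for } 1\le i\le m-1\}$ and $X=\{p\in Y: g_m(p)=c_m\}$. Assume: $Y$ is bounded and connected; the gradients $\nabla g_1(p),\dots,\nabla g_{m-1}(p)$ are linearly independent at every $p\in Y$; the restriction $g_m|_Y$ has only finitely many critical values; and $X\neq\emptyset$. If the social choice problem over $X$ has a solution, then $c_m$ is the global maximum or the global minimum of $g_m|_Y$.
   Context: Under the assumptions, $Y$ is a compact smooth submanifold of $\mathbb{R}^n$ of dimension $n-m+1$. A point $p\in Y$ is a critical point of $g_m|_Y$ if $\nabla g_m(p)$ is a linear combination of $\nabla g_1(p),\dots,\nabla g_{m-1}(p)$; its value $g_m(p)$ is then a critical value. For $X\subseteq\mathbb{R}^n$ and $k\ge 2$, a social choice function (SCF) for $k$ agents over $X$ is a continuous map $F:X^k\to X$ which is anonymous ($F(p_1,\dots,p_k)$ invariant under permutations of the arguments) and unanimous ($F(p,\dots,p)=p$ for all $p\in X$). "The social choice problem over $X$ has a solution" means that for every $k\ge 2$ an SCF for $k$ agents over $X$ exists. *)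

theory Defs
  imports "HOL-Analysis.Analysis"
begin

coinductive smooth_fun :: "('a::euclidean_space \<Rightarrow> real) \<Rightarrow> bool" where
  "(\<forall>x. f differentiable (at x)) \<Longrightarrow>
   (\<forall>b\<in>Basis. smooth_fun (\<lambda>x. frechet_derivative f (at x) b)) \<Longrightarrow> smooth_fun f"

definition grad :: "(real^'n \<Rightarrow> real) \<Rightarrow> real^'n \<Rightarrow> real^'n" where
  "grad f p = (\<chi> i. frechet_derivative f (at p) (axis i 1))"

definition lin_indep_family :: "('i \<Rightarrow> 'a::real_vector) \<Rightarrow> 'i set \<Rightarrow> bool" where
  "lin_indep_family v I \<longleftrightarrow> inj_on v I \<and> independent (v ` I)"

text \<open>Critical points of g m restricted to Y: gradient of g m is a linear
combination of the gradients of g 1, ..., g (m-1).\<close>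
definition critical_points ::
  "(nat \<Rightarrow> real^'n \<Rightarrow> real) \<Rightarrow> nat \<Rightarrow> (real^'n) set \<Rightarrow> (real^'n) set" where
  "critical_points g m Y =
     {p \<in> Y. grad (g m) p \<in> span ((\<lambda>i. grad (g i) p) ` {1..m-1})}"

definition critical_values ::
  "(nat \<Rightarrow> real^'n \<Rightarrow> real) \<Rightarrow> nat \<Rightarrow> (real^'n) set \<Rightarrow> real set" where
  "critical_values g m Y = g m ` critical_points g m Y"

text \<open>Social choice function for k agents over X; X^k is represented as the
extensional functions {..<k} \<rightarrow> X with the product topology.\<close>
definition is_SCF :: "nat \<Rightarrow> ('a::topological_space) set \<Rightarrow> ((nat \<Rightarrow> 'a) \<Rightarrow> 'a) \<Rightarrow> bool" where
  "is_SCF k X F \<longleftrightarrow>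
     continuous_on (PiE {..<k} (\<lambda>_. X)) F \<and>
     F ` PiE {..<k} (\<lambda>_. X) \<subseteq> X \<and>
     (\<forall>p\<in>PiE {..<k} (\<lambda>_. X). \<forall>\<sigma>. \<sigma> permutes {..<k} \<longrightarrow> F (p \<circ> \<sigma>) = F p) \<and>
     (\<forall>x\<in>X. F (\<lambda>i\<in>{..<k}. x) = x)"

definition social_choice_solvable :: "('a::topological_space) set \<Rightarrow> bool" where
  "social_choice_solvable X \<longleftrightarrow> (\<forall>k\<ge>2. \<exists>F. is_SCF k X F)"

end

theory Submission
  imports Defs "HOL-Homology.Homology"
begin

text \<open>Two agents suffice. Suppose \<open>g m\<close> takes values on both sides of \<open>c m\<close> on \<open>Y\<close>, and extend a choice
  function \<open>F\<close> on \<open>X \<times> X\<close> continuously and symmetrically to the whole space. A path in \<open>Y\<close> joining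
  the two sides, thickened in the normal directions, is a cube \<open>\<delta>\<close> of dimension \<open>m\<close> that meets \<open>X\<close>
  algebraically once. Put \<open>x = a + b\<close>, \<open>y = a - b\<close> and consider, for the unknowns \<open>a\<close>, \<open>b\<close> and \<open>s\<close>, the
  equations \<open>g i x = c i = g i y\<close> for \<open>i \<le> m\<close>, \<open>F (x, y) = \<delta> s\<close>, and the vanishing of \<open>n - m - 1\<close>
  coordinates of \<open>b\<close>. Exchanging the agents is the involution \<open>b \<mapsto> - b\<close>; the system is equivariant for
  it and has one odd equation fewer than odd unknowns. On the fixed space \<open>b = 0\<close> it reduces, because
  \<open>F (a, a) = a\<close>, to a system homotopic to the identity. A relative form of the Borsuk-Ulam theorem
  then gives solutions of arbitrarily large norm, although every solution has \<open>x\<close> and \<open>y\<close> in the bounded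
  set \<open>X\<close> and \<open>s\<close> in the cube.\<close>

section \<open>Equivariant maps of spheres\<close>

lemma trivial_homology_imp_boundary:
  assumes "trivial_group (homology_group (int p) X)" and "singular_relcycle p X {} c"
  shows "singular_relboundary p X {} c"
proof -
  have "homologous_rel_set p X {} c \<in> carrier (homology_group (int p) X)"
    using assms(2) by (auto simp: carrier_relative_homology_group)
  then have "homologous_rel_set p X {} c = singular_relboundary_set p X {}"
    using assms(1) by (auto simp: trivial_group_def)
  then show ?thesis
    using homologous_rel_set_eq_relboundary by blast
qed

lemma contractible_imp_boundary:
  assumes "contractible_space X" "p > 0" "singular_relcycle p X {} c"
  shows "singular_relboundary p X {} c"
  using assms trivial_reduced_homology_group_contractible_space[of X "int p"]
  by (intro trivial_homology_imp_boundary) (auto simp: un_reduced_homology_group)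

lemma nsphere_imp_boundary:
  assumes "p > 0" "p \<noteq> n" "singular_relcycle p (nsphere n) {} c"
  shows "singular_relboundary p (nsphere n) {} c"
  using assms reduced_homology_group_nsphere(2)[of "int p" n]
  by (intro trivial_homology_imp_boundary) (auto simp: un_reduced_homology_group)

text \<open>Divisibility by two in integral homology stands in for coefficients mod 2: a cycle is
  odd when its class has no half. The half must itself be an absolute cycle.\<close>

definition twice_class :: "nat \<Rightarrow> 'a topology \<Rightarrow> 'a chain \<Rightarrow> bool"
  where "twice_class p X c \<longleftrightarrow> (\<exists>w. singular_relcycle p X {} w \<and> homologous_rel p X {} c (w + w))"

lemma homologous_rel_set_add:
  assumes "singular_relcycle p X S a" "singular_relcycle p X S b"
  shows "homologous_rel_set p X S a \<otimes>\<^bsub>relative_homology_group (int p) X S\<^esub> homologous_rel_set p X S b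
         = homologous_rel_set p X S (a + b)"
proof -
  interpret N: normal "singular_relboundary_set p X S" "relcycle_group p X S"
    by (rule normal_subgroup_singular_relboundary_relcycle)
  show ?thesis
    using N.rcos_sum[of a b] assms
    by (simp add: nontrivial_relative_homology_group FactGroup_def right_coset_singular_relboundary)
qed

text \<open>The cycle represents the preimage of 1 under an isomorphism of the homology group with
  the integers, and 1 is not even.\<close>

lemma odd_cycle_nsphere_exists:
  assumes "p > 0"
  obtains z where "singular_relcycle p (nsphere p) {} z" "\<not> twice_class p (nsphere p) z"
proof -
  let ?H = "homology_group (int p) (nsphere p)"
  have "reduced_homology_group (int p) (nsphere p) = ?H"
    using assms by (simp add: un_reduced_homology_group)
  then have "?H \<cong> integer_group"
    using reduced_homology_group_nsphere(1)[of p] by simp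
  then obtain f where f: "f \<in> iso ?H integer_group"
    by (auto simp: is_iso_def)
  then have "1 \<in> f ` carrier ?H"
    by (auto simp: iso_def bij_betw_def)
  then obtain z where z: "singular_relcycle p (nsphere p) {} z" "f (homologous_rel_set p (nsphere p) {} z) = 1"
    by (auto simp: carrier_relative_homology_group)
  have "\<not> twice_class p (nsphere p) z"
  proof
    assume "twice_class p (nsphere p) z"
    then obtain w where w: "singular_relcycle p (nsphere p) {} w"
      "homologous_rel_set p (nsphere p) {} z = homologous_rel_set p (nsphere p) {} (w + w)"
      unfolding twice_class_def homologous_rel_set_eq by blast
    let ?w = "homologous_rel_set p (nsphere p) {} w"
    have "?w \<in> carrier ?H"
      using w by (auto simp: carrier_relative_homology_group)
    then have "f (?w \<otimes>\<^bsub>?H\<^esub> ?w) = f ?w + f ?w"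
      using f by (auto simp: iso_def hom_def)
    then have "1 = f ?w + f ?w"
      using z w by (simp add: homologous_rel_set_add)
    then show False
      by presburger
  qed
  with z that show ?thesis by blast
qed

text \<open>The degree of an involution squares to 1, and the induced map on homology is
  multiplication by the degree.\<close>

lemma chain_map_involution_nsphere:
  assumes p: "p > 0" and T: "continuous_map (nsphere p) (nsphere p) T"
    and inv: "\<And>x. x \<in> topspace (nsphere p) \<Longrightarrow> T (T x) = x"
    and w: "singular_relcycle p (nsphere p) {} w"
  shows "homologous_rel p (nsphere p) {} (chain_map p T w) w \<or>
         homologous_rel p (nsphere p) {} (chain_map p T w) (- w)"
proof -
  let ?H = "homology_group (int p) (nsphere p)" and ?d = "Brouwer_degree2 p T"
  let ?c = "homologous_rel_set p (nsphere p) {}"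
  have red: "reduced_homology_group (int p) (nsphere p) = ?H"
    using p by (simp add: un_reduced_homology_group)
  interpret group ?H by simp
  have "Brouwer_degree2 p (T \<circ> T) = ?d * ?d"
    using T T by (rule Brouwer_degree2_compose)
  moreover have "Brouwer_degree2 p (T \<circ> T) = Brouwer_degree2 p id"
    by (rule Brouwer_degree2_eq) (simp add: inv)
  ultimately have "?d * ?d = 1" by simp
  then have d: "?d = 1 \<or> ?d = -1"
    by (metis zmult_eq_1_iff)
  have cw: "?c w \<in> carrier ?H"
    using w by (auto simp: carrier_relative_homology_group)
  have "?c (chain_map p T w) = ?c w [^]\<^bsub>?H\<^esub> ?d"
    using Brouwer_degree2[of "?c w" p T] cw T w
    by (simp add: red hom_induced_chain_map)
  with d show ?thesis
  proof (elim disjE)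
    assume "?d = 1" "?c (chain_map p T w) = ?c w [^]\<^bsub>?H\<^esub> ?d"
    then have "?c (chain_map p T w) = ?c w"
      using cw int_pow_1 by simp
    then show ?thesis
      by (simp add: homologous_rel_set_eq)
  next
    assume "?d = -1" "?c (chain_map p T w) = ?c w [^]\<^bsub>?H\<^esub> ?d"
    then have "?c (chain_map p T w) = uminus ` ?c w"
      using cw by (simp add: int_pow_neg int_pow_1 inv_relative_homology_group)
    moreover have "- w \<in> uminus ` ?c w"
      by simp
    ultimately have "- w \<in> ?c (chain_map p T w)"
      by simp
    then show ?thesis
      by simp
  qed
qed

text \<open>Since \<open>T\<close> acts on the homology by a sign, the sum is homologous to
  \<open>w + w\<close> or to 0, and both have a half.\<close>

lemma twice_class_involution_nsphere:
  assumes p: "p > 0" and T: "continuous_map (nsphere p) (nsphere p) T"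
    and inv: "\<And>x. x \<in> topspace (nsphere p) \<Longrightarrow> T (T x) = x"
    and w: "singular_relcycle p (nsphere p) {} w" and e: "e = 1 \<or> e = -1"
  shows "twice_class p (nsphere p) (w + frag_cmul e (chain_map p T w))"
proof -
  let ?h = "homologous_rel p (nsphere p) {}"
  have *: "?h (frag_cmul e (chain_map p T w)) w \<or> ?h (frag_cmul e (chain_map p T w)) (- w)"
    using chain_map_involution_nsphere[OF assms(1-4)] e
     singular_relboundary_minus[of p "nsphere p" "{}"]
    unfolding homologous_rel_def
    by (metis (no_types, opaque_lifting) frag_cmul_one frag_cmul_minus_one minus_diff_minus minus_minus) 
  then show ?thesis
  proof
    assume "?h (frag_cmul e (chain_map p T w)) w"
    then have "?h (w + frag_cmul e (chain_map p T w)) (w + w)"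
      by (intro homologous_rel_add) auto
    with w show ?thesis unfolding twice_class_def by blast
  next
    assume "?h (frag_cmul e (chain_map p T w)) (- w)"
    then have "?h (w + frag_cmul e (chain_map p T w)) (w + - w)"
      by (intro homologous_rel_add) auto
    then show ?thesis unfolding twice_class_def by (intro exI[of _ 0]) auto
  qed
qed

section \<open>Oddness passes from the equator to the sphere\<close>

lemma nsphere_eq_equator:
  "subtopology (subtopology (nsphere (Suc n)) {x. x (Suc n) \<ge> 0}) {x. x (Suc n) = 0} = nsphere n"
proof -
  have "{x. 0 \<le> x (Suc n)} \<inter> {x. x (Suc n) = 0} = {x. x (Suc n) = (0::real)}"
    by auto
  then show ?thesis
    by (simp add: subtopology_nsphere_equator subtopology_subtopology)
qed

lemma singular_chain_nsphere_mono:
  assumes "singular_chain p (nsphere m) c" "m \<le> n"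
  shows "singular_chain p (nsphere n) c"
  using assms(2,1)
proof (induction rule: dec_induct)
  case (step n)
  then show ?case
    by (metis subtopology_nsphere_equator singular_chain_subtopology)
qed auto

text \<open>Relative to the lower hemisphere \<open>t\<close> disappears, and that relative homology
  is the one of the upper hemisphere relative to the equator. A half of \<open>h + t\<close> thus
  yields a half \<open>v\<close> of \<open>h\<close> relative to the equator, and the boundary of
  \<open>v\<close> is a half of the boundary of \<open>h\<close>.\<close>

lemma odd_class_suspension:
  assumes h: "singular_chain (Suc n) (subtopology (nsphere (Suc n)) {x. x (Suc n) \<ge> 0}) h"
    and bh: "singular_chain n (nsphere n) (chain_boundary (Suc n) h)"
    and t: "singular_chain (Suc n) (subtopology (nsphere (Suc n)) {x. x (Suc n) \<le> 0}) t"
    and odd: "\<not> twice_class n (nsphere n) (chain_boundary (Suc n) h)"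
  shows "\<not> twice_class (Suc n) (nsphere (Suc n)) (h + t)"
proof
  let ?X = "nsphere (Suc n)"
  let ?U = "subtopology ?X {x. x (Suc n) \<ge> 0}" and ?E = "{x::nat\<Rightarrow>real. x (Suc n) = 0}"
    and ?L = "{x::nat\<Rightarrow>real. x (Suc n) \<le> 0}"
  let ?i = "hom_induced (int (Suc n)) ?U ?E ?X ?L id"
  let ?G = "relative_homology_group (int (Suc n)) ?U ?E"
  let ?H = "relative_homology_group (int (Suc n)) ?X ?L"
  have cont: "continuous_map ?U ?X id" and im: "id \<in> ?E \<rightarrow> ?L"
    by (auto simp: continuous_map_from_subtopology)
  have iso: "?i \<in> iso ?G ?H"
    by (rule iso_relative_homology_group_upper_hemisphere)
  assume "twice_class (Suc n) ?X (h + t)"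
  then obtain w where w: "singular_relcycle (Suc n) ?X {} w"
    and hw: "homologous_rel (Suc n) ?X {} (h + t) (w + w)"
    by (auto simp: twice_class_def)
  then obtain u where u: "singular_chain (Suc (Suc n)) ?X u" "chain_boundary (Suc (Suc n)) u = h + t - (w + w)"
    by (auto simp: homologous_rel_def singular_boundary)
  \<comment> \<open>The chain \<open>t\<close> lies in the lower hemisphere, so it may be absorbed
    into the relative part.\<close>
  have "chain_boundary (Suc (Suc n)) u + (- t) = h - (w + w)"
    using u by simp
  then have 1: "homologous_rel (Suc n) ?X ?L h (w + w)"
    using u t singular_chain_minus unfolding homologous_rel_def singular_relboundary by blast
  have w': "singular_relcycle (Suc n) ?X ?L w"
  proof -
    have "singular_chain (Suc n) ?X w" "chain_boundary (Suc n) w = 0"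
      using w by (simp_all only: singular_cycle)
    then show ?thesis by (simp add: singular_relcycle)
  qed
  have hc: "singular_relcycle (Suc n) ?U ?E h"
    using h bh by (simp add: singular_relcycle nsphere_eq_equator)
  have "homologous_rel_set (Suc n) ?X ?L w \<in> carrier ?H"
    using w' carrier_relative_homology_group by blast
  then have "homologous_rel_set (Suc n) ?X ?L w \<in> ?i ` carrier ?G"
    using iso by (simp add: iso_def bij_betw_def)
  then obtain v where v: "singular_relcycle (Suc n) ?U ?E v"
     and vw: "?i (homologous_rel_set (Suc n) ?U ?E v) = homologous_rel_set (Suc n) ?X ?L w"
    unfolding carrier_relative_homology_group by (elim imageE) simp
  have ind: "?i (homologous_rel_set (Suc n) ?U ?E c) = homologous_rel_set (Suc n) ?X ?L c"
    if "singular_relcycle (Suc n) ?U ?E c" for c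
    using that hom_induced_chain_map[OF cont im that] chain_map_ident[of "Suc n" ?U c]
    by (simp add: singular_relcycle)
  have "homologous_rel (Suc n) ?X ?L v w"
    using ind[OF v] vw by (simp add: homologous_rel_set_eq)
  then have "homologous_rel (Suc n) ?X ?L (v + v) (w + w)"
    by (intro homologous_rel_add)
  then have "homologous_rel (Suc n) ?X ?L h (v + v)"
    using 1 by (meson homologous_rel_sym homologous_rel_trans)
  then have "?i (homologous_rel_set (Suc n) ?U ?E h) = ?i (homologous_rel_set (Suc n) ?U ?E (v + v))"
    using ind[OF hc] ind[OF singular_relcycle_add[OF v v]] by (simp only: homologous_rel_set_eq)
  moreover have "homologous_rel_set (Suc n) ?U ?E h \<in> carrier ?G" "homologous_rel_set (Suc n) ?U ?E (v+v) \<in> carrier ?G"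
    using hc singular_relcycle_add[OF v v] carrier_relative_homology_group by blast+
  ultimately have "homologous_rel_set (Suc n) ?U ?E h = homologous_rel_set (Suc n) ?U ?E (v + v)"
    using iso by (auto simp: iso_def bij_betw_def inj_on_def)
  then have "singular_relboundary (Suc n) ?U ?E (h - (v + v))"
    unfolding homologous_rel_set_eq by (simp only: homologous_rel_def)
  then obtain d e where d: "singular_chain (Suc (Suc n)) ?U d" and e: "singular_chain (Suc n) (nsphere n) e"
     and de: "chain_boundary (Suc (Suc n)) d + e = h - (v + v)"
    by (auto simp: singular_relboundary nsphere_eq_equator)
  \<comment> \<open>Taking boundaries removes \<open>d\<close>; the chain \<open>e\<close> on the
    equator then witnesses the homology that contradicts \<open>odd\<close>.\<close>
  have "chain_boundary (Suc n) e = chain_boundary (Suc n) (chain_boundary (Suc (Suc n)) d + e)"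
    using chain_boundary_boundary[OF d] by (simp add: chain_boundary_add)
  also have "\<dots> = chain_boundary (Suc n) h - (chain_boundary (Suc n) v + chain_boundary (Suc n) v)"
    unfolding de by (simp add: chain_boundary_add chain_boundary_diff)
  finally have "homologous_rel n (nsphere n) {} (chain_boundary (Suc n) h) (chain_boundary (Suc n) v + chain_boundary (Suc n) v)"
    using e unfolding homologous_rel_def singular_boundary by blast
  moreover have "singular_relcycle n (nsphere n) {} (chain_boundary (Suc n) v)"
    using v chain_boundary_boundary[of "Suc n" ?U v]
    by (auto simp: singular_relcycle nsphere_eq_equator singular_cycle)
  ultimately show False
    using odd by (auto simp: twice_class_def)
qed

section \<open>The coordinate reflection and maps equivariant under it\<close>

lemma frag_cmul_diff: "frag_cmul e (a - b) = frag_cmul e a - frag_cmul e b"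
  by (rule poly_mapping_eqI) (simp add: lookup_minus right_diff_distrib)

text \<open>The bound is inclusive: the coordinates 0 to \<open>q\<close> are kept, so for
  \<open>n \<ge> q\<close> the fixed points in \<open>nsphere n\<close> form exactly
  \<open>nsphere q\<close>.\<close>

definition flip_from :: "nat \<Rightarrow> (nat \<Rightarrow> real) \<Rightarrow> nat \<Rightarrow> real"
  where "flip_from q x = (\<lambda>i. if i \<le> q then x i else - x i)"

lemma flip_from_flip_from [simp]: "flip_from q (flip_from q x) = x"
  by (auto simp: flip_from_def)

lemma continuous_map_flip_from: "continuous_map (nsphere n) (nsphere n) (flip_from q)"
proof -
  have "(flip_from q x i)\<^sup>2 = (x i)\<^sup>2" for x i
    by (simp add: flip_from_def)
  moreover have "continuous_map (powertop_real UNIV) euclideanreal (\<lambda>x. flip_from q x i)" for i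
    by (cases "i \<le> q") (auto simp: flip_from_def intro!: continuous_map_product_projection)
  ultimately show ?thesis
    unfolding nsphere continuous_map_in_subtopology continuous_map_componentwise_UNIV
    by (intro conjI allI continuous_map_from_subtopology) (auto simp: flip_from_def)
qed

text \<open>The comparison argument at chain level: hemispheres \<open>h\<close> of increasing dimension satisfy
  \<open>\<partial>h' = h + e T h\<close>, and \<open>\<phi> h - h - d\<close> stays a cycle for some correction \<open>d\<close> annihilated by
  \<open>1 + e T\<close>.\<close>

lemma no_equivariant_map_fixed_identity:
  assumes q: "q > 0" and k: "k > 0"
    and cont: "continuous_map (nsphere (q + 1 + k)) (nsphere (q + k)) \<phi>"
    and equiv: "\<And>x. x \<in> topspace (nsphere (q + 1 + k)) \<Longrightarrow> \<phi> (flip_from q x) = flip_from q (\<phi> x)"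
    and hom: "homotopic_with (\<lambda>_. True) (nsphere q) (nsphere q) \<phi> id"
  shows False
proof -
  define T where "T = flip_from q"
  define M where "M = q + k"
  have contT: "continuous_map (nsphere n) (nsphere n) T" for n
    unfolding T_def by (rule continuous_map_flip_from)
  have TT: "chain_map p T (chain_map p T c) = c" if "singular_chain p (nsphere n) c" for p n c
  proof -
    have "chain_map p (T \<circ> T) c = c"
      using that by (rule chain_map_id_gen) (simp add: T_def)
    then show ?thesis by (simp add: chain_map_compose)
  qed
  have chT: "singular_chain p (nsphere n) (chain_map p T c)" if "singular_chain p (nsphere n) c" for p n c
    using that contT by (rule singular_chain_chain_map)
  have phiT: "chain_map p \<phi> (chain_map p T c) = chain_map p T (chain_map p \<phi> c)"
    if "singular_chain p (nsphere (q + 1 + k)) c" for p c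
  proof -
    have "chain_map p (\<phi> \<circ> T) c = chain_map p (T \<circ> \<phi>) c"
      using that by (rule chain_map_eq) (simp add: T_def equiv)
    then show ?thesis by (simp add: chain_map_compose)
  qed
  have chphi: "singular_chain p (nsphere M) (chain_map p \<phi> c)"
    if "singular_chain p (nsphere n) c" "n \<le> q + 1 + k" for p n c
    unfolding M_def using singular_chain_nsphere_mono[OF that] cont by (rule singular_chain_chain_map)
  have bT: "chain_boundary (Suc p) (chain_map (Suc p) T c) = chain_map p T (chain_boundary (Suc p) c)"
    if "singular_chain (Suc p) (nsphere n) c" for p n c
    using chain_boundary_chain_map[OF that, of T] by simp
  have bphi: "chain_boundary (Suc p) (chain_map (Suc p) \<phi> c) = chain_map p \<phi> (chain_boundary (Suc p) c)"
    if "singular_chain (Suc p) (nsphere n) c" for p n c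
    using chain_boundary_chain_map[OF that, of \<phi>] by simp
  have hemi: "\<exists>h. singular_chain (Suc n) (subtopology (nsphere (Suc n)) {x. x (Suc n) \<ge> 0}) h \<and>
                  chain_boundary (Suc n) h = c"
    if "n > 0" "singular_relcycle n (nsphere n) {} c" for n c
  proof -
    let ?U = "subtopology (nsphere (Suc n)) {x. x (Suc n) \<ge> 0}"
    have "singular_relcycle n ?U {} c"
      using that(2) unfolding singular_cycle nsphere_eq_equator[of n, symmetric]
      by (simp add: singular_chain_subtopology)
    then have "singular_relboundary n ?U {} c"
      using that(1) contractible_space_upper_hemisphere[of "Suc n" "Suc n"]
      by (intro contractible_imp_boundary) auto
    then show ?thesis by (auto simp: singular_boundary)
  qed
  \<comment> \<open>For \<open>n > q\<close> the reflection negates the last coordinate and so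
    carries the upper hemisphere to the lower one.\<close>
  have lower: "singular_chain p (subtopology (nsphere n) {x. x n \<le> 0}) (chain_map p T c)"
    if "singular_chain p (subtopology (nsphere n) {x. x n \<ge> 0}) c" "q < n" for p n c
  proof (rule singular_chain_chain_map[OF that(1)])
    show "continuous_map (subtopology (nsphere n) {x. x n \<ge> 0}) (subtopology (nsphere n) {x. x n \<le> 0}) T"
      using that(2) contT[of n]
      by (auto simp: continuous_map_in_subtopology continuous_map_from_subtopology T_def flip_from_def)
  qed
  have up: "singular_chain p (nsphere n) c"
    if "singular_chain p (subtopology (nsphere n) A) c" for p n c A
    using that by (simp add: singular_chain_subtopology)
  \<comment> \<open>Here \<open>h\<close> acts as a hemisphere of dimension
    \<open>q + 1 + i\<close>, and \<open>h + e T h\<close> as the full sphere, of which only oddness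
    is recorded. The sign \<open>e\<close> alternates with \<open>i\<close>, because
    \<open>1 - e T\<close> annihilates the image of \<open>1 + e T\<close>.\<close>
  define P where "P = (\<lambda>i e h d.
      singular_chain (q + 1 + i) (nsphere (q + 1 + i)) h \<and>
      chain_boundary (q + 1 + i) (h + frag_cmul e (chain_map (q + 1 + i) T h)) = 0 \<and>
      \<not> twice_class (q + 1 + i) (nsphere (q + 1 + i)) (h + frag_cmul e (chain_map (q + 1 + i) T h)) \<and>
      singular_chain (q + 1 + i) (nsphere M) d \<and>
      d + frag_cmul e (chain_map (q + 1 + i) T d) = 0 \<and>
      chain_boundary (q + 1 + i) (chain_map (q + 1 + i) \<phi> h - h - d) = 0)"
  have ex: "i < k \<Longrightarrow> \<exists>e h d. (e = 1 \<or> e = -1) \<and> P i e h d" for i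
  proof (induction i)
    case 0
    obtain z where z: "singular_relcycle q (nsphere q) {} z" "\<not> twice_class q (nsphere q) z"
      using odd_cycle_nsphere_exists[OF q] .
    obtain h where h: "singular_chain (Suc q) (subtopology (nsphere (Suc q)) {x. x (Suc q) \<ge> 0}) h"
      "chain_boundary (Suc q) h = z"
      using hemi[OF q z(1)] by blast
    have zc: "singular_chain q (nsphere q) z"
      using z by (simp add: singular_cycle)
    have Tz: "chain_map q T c = c" if "singular_chain q (nsphere q) c" for c
      using that by (rule chain_map_id_gen) (auto simp: T_def flip_from_def nsphere)
    have Tz': "chain_map (Suc q) T c = c" if "singular_chain (Suc q) (nsphere q) c" for c
      using that by (rule chain_map_id_gen) (auto simp: T_def flip_from_def nsphere)
    have "homologous_rel q (nsphere q) {} (chain_map q \<phi> z) (chain_map q id z)"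
      by (rule homotopic_imp_homologous_rel_chain_maps[OF _ z(1)]) (use hom in simp)
    then have "homologous_rel q (nsphere q) {} (chain_map q \<phi> z) z"
      using zc by (simp add: chain_map_ident)
    \<comment> \<open>The homotopy on \<open>nsphere q\<close> provides \<open>d\<close> as a chain
      of that sphere. There \<open>T\<close> is the identity, so \<open>1 - T\<close> kills
      \<open>d\<close>, which fits the initial sign \<open>-1\<close>.\<close>
    then obtain d where d: "singular_chain (Suc q) (nsphere q) d" "chain_boundary (Suc q) d = chain_map q \<phi> z - z"
      by (auto simp: homologous_rel_def singular_boundary)
    have "P 0 (-1) h d"
      unfolding P_def
    proof (intro conjI)
      have *: "singular_chain (Suc q) (nsphere (Suc q)) h"
        using h up by blast
      then show "singular_chain (q + 1 + 0) (nsphere (q + 1 + 0)) h" by simp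
      show "singular_chain (q + 1 + 0) (nsphere M) d"
        using singular_chain_nsphere_mono[OF d(1), of M] by (simp add: M_def)
      show "d + frag_cmul (- 1) (chain_map (q + 1 + 0) T d) = 0"
        using Tz'[OF d(1)] by simp
      show "chain_boundary (q + 1 + 0) (h + frag_cmul (- 1) (chain_map (q + 1 + 0) T h)) = 0"
        using bT[OF *] Tz[OF zc] h by (simp add: chain_boundary_diff)
      show "chain_boundary (q + 1 + 0) (chain_map (q + 1 + 0) \<phi> h - h - d) = 0"
        using bphi[OF *] h d by (simp add: chain_boundary_diff)
      show "\<not> twice_class (q + 1 + 0) (nsphere (q + 1 + 0)) (h + frag_cmul (- 1) (chain_map (q + 1 + 0) T h))"
        using odd_class_suspension[of q h "- chain_map (Suc q) T h"] h z zc lower[OF h(1)]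
        by (simp add: singular_chain_minus)
    qed
    then show ?case by blast
  next
    case (Suc i)
    then obtain e h d where e: "e = 1 \<or> e = -1" and P: "P i e h d"
      by auto
    define n where "n = q + 1 + i"
    have n: "n > 0" "n < M" "n \<le> q + 1 + k" "q < Suc n" "Suc n \<le> q + 1 + k" "Suc n \<le> M"
      using Suc.prems by (auto simp: n_def M_def)
    define T' where "T' = chain_map n T"
    define \<kappa> where "\<kappa> = h + frag_cmul e (T' h)"
    have h: "singular_chain n (nsphere n) h" and bk: "chain_boundary n \<kappa> = 0"
      and odd: "\<not> twice_class n (nsphere n) \<kappa>"
      and d: "singular_chain n (nsphere M) d" and dT: "d + frag_cmul e (T' d) = 0"
      and bw: "chain_boundary n (chain_map n \<phi> h - h - d) = 0"
      using P by (simp_all add: P_def n_def \<kappa>_def T'_def)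
    have ee: "frag_cmul e (frag_cmul e c) = c" for c :: "(nat \<Rightarrow> real) chain"
      using e by auto
    have kc: "singular_chain n (nsphere n) \<kappa>"
      unfolding \<kappa>_def T'_def using h by (intro singular_chain_add singular_chain_cmul chT)
    obtain h' where h': "singular_chain (Suc n) (subtopology (nsphere (Suc n)) {x. x (Suc n) \<ge> 0}) h'"
      "chain_boundary (Suc n) h' = \<kappa>"
      using hemi[OF n(1), of \<kappa>] kc bk by (auto simp: singular_cycle)
    define w where "w = chain_map n \<phi> h - h - d"
    have wc: "singular_chain n (nsphere M) w"
      unfolding w_def using h d n chphi singular_chain_nsphere_mono
      by (intro singular_chain_diff) auto
    \<comment> \<open>Below the top dimension, \<open>0 < n < M\<close>, every cycle of
      \<open>nsphere M\<close> bounds.\<close>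
    have "singular_relboundary n (nsphere M) {} w"
      using n wc bw by (intro nsphere_imp_boundary) (auto simp: singular_cycle w_def)
    then obtain u where u: "singular_chain (Suc n) (nsphere M) u" "chain_boundary (Suc n) u = w"
      by (auto simp: singular_boundary)
    define T'' where "T'' = chain_map (Suc n) T"
    have T''T'': "T'' (T'' c) = c" if "singular_chain (Suc n) (nsphere m) c" for c m
      using TT that unfolding T''_def by blast
    have bT': "chain_boundary (Suc n) (T'' c) = T' (chain_boundary (Suc n) c)" 
      if "singular_chain (Suc n) (nsphere m) c" for c m
      using bT that unfolding T''_def T'_def by blast
    have Tadd: "T' (a + b) = T' a + T' b" "T' (a - b) = T' a - T' b" "T' (frag_cmul e a) = frag_cmul e (T' a)" for a b
      by (simp_all add: T'_def chain_map_add chain_map_diff)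
    have T2add: "T'' (a + b) = T'' a + T'' b" "T'' (frag_cmul e a) = frag_cmul e (T'' a)" for a b
      by (simp_all add: T''_def chain_map_add)
    have T'T': "T' (T' h) = h"
      using TT h unfolding T'_def by blast
    have [simp]: "e * e = 1"
      using e by auto
    have TTk: "frag_cmul e (T' \<kappa>) = \<kappa>"
      by (simp add: \<kappa>_def Tadd T'T' frag_cmul_distrib2 ee)
    then have TTk': "frag_cmul (- e) (T' \<kappa>) = - \<kappa>"
      by (simp flip: minus_frag_cmul)
    have h'c: "singular_chain (Suc n) (nsphere (Suc n)) h'"
      using h' up by blast
    \<comment> \<open>The correction \<open>(1 + e T) u\<close> is killed by \<open>1 - e T\<close>.
      Its boundary is \<open>(1 + e T) w\<close>, which differs from
      \<open>\<phi> \<kappa> - \<kappa>\<close> by \<open>d + e T d = 0\<close>, so the new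
      difference is again a cycle.\<close>
    have "P (Suc i) (-e) h' (u + frag_cmul e (T'' u))"
      unfolding P_def
    proof (intro conjI)
      have nn: "q + 1 + Suc i = Suc n" by (simp add: n_def)
      show "singular_chain (q + 1 + Suc i) (nsphere (q + 1 + Suc i)) h'"
        unfolding nn by (rule h'c)
      show "singular_chain (q + 1 + Suc i) (nsphere M) (u + frag_cmul e (T'' u))"
        unfolding nn T''_def using u by (intro singular_chain_add singular_chain_cmul chT)
      show "u + frag_cmul e (T'' u) + frag_cmul (- e) (chain_map (q + 1 + Suc i) T (u + frag_cmul e (T'' u))) = 0"
        unfolding nn using T''T''[OF u(1)] frag_cmul_distrib[of e "- e" "T'' u"]
        by (simp add: T2add frag_cmul_distrib2 ee flip: T''_def)
      show "chain_boundary (q + 1 + Suc i) (h' + frag_cmul (- e) (chain_map (q + 1 + Suc i) T h')) = 0"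
        unfolding nn using bT'[OF h'c] h' TTk'
        by (simp add: chain_boundary_add chain_boundary_cmul flip: T''_def)
      show "\<not> twice_class (q + 1 + Suc i) (nsphere (q + 1 + Suc i)) (h' + frag_cmul (- e) (chain_map (q + 1 + Suc i) T h'))"
        unfolding nn using odd_class_suspension[OF h'(1) _ singular_chain_cmul[OF lower[OF h'(1) n(4)]]]
          h'(2) kc odd by simp
      have "chain_boundary (Suc n) (chain_map (Suc n) \<phi> h' - h' - (u + frag_cmul e (T'' u)))
         = chain_map n \<phi> \<kappa> - \<kappa> - (w + frag_cmul e (T' w))"
        using bphi[OF h'c] h' u bT'[OF u(1)]
        by (simp add: chain_boundary_diff chain_boundary_add chain_boundary_cmul)
      also have "chain_map n \<phi> \<kappa> = chain_map n \<phi> h + frag_cmul e (T' (chain_map n \<phi> h))"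
        using phiT[OF singular_chain_nsphere_mono[OF h n(3)]]
        by (simp add: \<kappa>_def chain_map_add T'_def)
      also have "\<dots> - \<kappa> - (w + frag_cmul e (T' w)) = d + frag_cmul e (T' d)"
        by (simp add: \<kappa>_def w_def Tadd frag_cmul_distrib2 algebra_simps frag_cmul_diff)
      finally show "chain_boundary (q + 1 + Suc i) (chain_map (q + 1 + Suc i) \<phi> h' - h' - (u + frag_cmul e (T'' u))) = 0"
        unfolding nn dT .
    qed
    then show ?case using e by (metis minus_minus)
  qed
  obtain e h d where e: "e = 1 \<or> e = -1" and P: "P (k - 1) e h d"
    using ex[of "k - 1"] k by auto
  have M: "q + 1 + (k - 1) = M" using k by (simp add: M_def)
  define T' where "T' = chain_map M T"
  define \<kappa> where "\<kappa> = h + frag_cmul e (T' h)"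
  define w where "w = chain_map M \<phi> h - h - d"
  have h: "singular_chain M (nsphere M) h" and bk: "chain_boundary M \<kappa> = 0"
    and odd: "\<not> twice_class M (nsphere M) \<kappa>"
    and d: "singular_chain M (nsphere M) d" and dT: "d + frag_cmul e (T' d) = 0"
    and bw: "chain_boundary M w = 0"
    using P by (simp_all add: P_def M \<kappa>_def w_def T'_def del: One_nat_def)
  have M0: "M > 0" "M \<le> q + 1 + k" "Suc M \<le> q + 1 + k" using q by (auto simp: M_def)
  have kc: "singular_chain M (nsphere M) \<kappa>"
    unfolding \<kappa>_def T'_def using h by (intro singular_chain_add singular_chain_cmul chT)
  \<comment> \<open>\<open>nsphere (Suc M)\<close> is the whole domain of \<open>\<phi>\<close>, so
    \<open>h'\<close> can be pushed forward to \<open>nsphere M\<close> and the image of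
    \<open>\<kappa>\<close> bounds there.\<close>
  obtain h' where h': "singular_chain (Suc M) (nsphere (Suc M)) h'" "chain_boundary (Suc M) h' = \<kappa>"
    using hemi[OF M0(1), of \<kappa>] kc bk up unfolding singular_cycle by blast
  have wc: "singular_relcycle M (nsphere M) {} w"
    unfolding singular_cycle using bw h d chphi[OF h M0(2)]
    by (auto simp: w_def intro!: singular_chain_diff)
  have "chain_map M \<phi> \<kappa> = chain_map M \<phi> h + frag_cmul e (T' (chain_map M \<phi> h))"
    using phiT[OF singular_chain_nsphere_mono[OF h M0(2)]]
    by (simp add: \<kappa>_def chain_map_add T'_def)
  then have "w + frag_cmul e (T' w) = chain_map M \<phi> \<kappa> - \<kappa> - (d + frag_cmul e (T' d))"
    by (simp add: \<kappa>_def w_def T'_def chain_map_diff chain_map_add frag_cmul_distrib2 algebra_simps frag_cmul_diff)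
  then have weq: "w + frag_cmul e (T' w) = chain_map M \<phi> \<kappa> - \<kappa>"
    using dT by simp
  \<comment> \<open>In the top dimension \<open>w\<close> need not bound, but
    \<open>(1 + e T) w\<close> is divisible by two. As it equals
    \<open>\<phi> \<kappa> - \<kappa>\<close> and \<open>\<phi> \<kappa>\<close> bounds,
    \<open>\<kappa>\<close> would be divisible by two as well.\<close>
  obtain v where v: "singular_relcycle M (nsphere M) {} v"
    "homologous_rel M (nsphere M) {} (w + frag_cmul e (T' w)) (v + v)"
    using twice_class_involution_nsphere[OF M0(1) contT _ wc e] 
    by (auto simp: twice_class_def T'_def T_def)
  have "singular_relboundary M (nsphere M) {} (chain_map M \<phi> \<kappa>)"
    unfolding singular_boundary
    using chphi[OF h'(1) M0(3)] bphi[OF h'(1)] h'(2) by blast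
  then have "homologous_rel M (nsphere M) {} (chain_map M \<phi> \<kappa> - (w + frag_cmul e (T' w))) (0 - (v + v))"
    using v by (intro homologous_rel_diff) (auto simp: homologous_rel_def)
  then have "homologous_rel M (nsphere M) {} \<kappa> (- v + - v)"
    by (simp add: weq)
  then have "twice_class M (nsphere M) \<kappa>"
    unfolding twice_class_def using v singular_relcycle_minus by blast
  then show False using odd by blast
qed

section \<open>Transfer to spheres in Euclidean spaces\<close>

lemma nsphere_eq_top_of_set:
  "nsphere n = top_of_set {x. (\<Sum>i\<le>n. (x i)\<^sup>2) = 1 \<and> (\<forall>i>n. x i = 0)}"
  by (simp add: nsphere euclidean_product_topology)

text \<open>With \<open>b0\<close> in the last place, a map whose \<open>b0\<close> component
  vanishes takes values in the equator of the coordinate sphere.\<close>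

lemma Basis_enumeration_last:
  fixes b0 :: "'a::euclidean_space"
  assumes "b0 \<in> Basis"
  obtains f :: "nat \<Rightarrow> 'a" where "bij_betw f {..<DIM('a)} Basis" "f (DIM('a) - 1) = b0"
proof -
  let ?n = "DIM('a) - 1"
  have "card (Basis - {b0}) = ?n"
    using assms by simp
  then obtain f where f: "bij_betw f {..<?n} (Basis - {b0})"
    using ex_bij_betw_nat_finite[of "Basis - {b0}"] by (auto simp: atLeast0LessThan)
  have "bij_betw (f(?n := b0)) (insert ?n {..<?n}) (insert b0 (Basis - {b0}))"
    unfolding bij_betw_def
  proof
    have im: "f ` {..<?n} = Basis - {b0}" and inj: "inj_on f {..<?n}"
      using f by (auto simp: bij_betw_def)
    then show "(f(?n := b0)) ` insert ?n {..<?n} = insert b0 (Basis - {b0})"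
      by (auto simp: image_iff set_eq_iff)
    show "inj_on (f(?n := b0)) (insert ?n {..<?n})"
      using inj im by (auto simp: inj_on_def set_eq_iff image_iff)
  qed
  moreover have "insert ?n {..<?n} = {..<DIM('a)}"
    using DIM_positive[where 'a='a] by (auto simp del: DIM_positive)
  ultimately show ?thesis
    using assms that[of "f(?n := b0)"] by (simp add: insert_absorb)
qed

text \<open>Without a zero, \<open>\<Psi>\<close> could be normalised to an equivariant map between
  coordinate spheres. The vanishing \<open>b0\<close> component lowers the dimension of the target
  by one, and \<open>hom\<close> makes the map homotopic to the identity on the fixed sphere, which
  \<open>no_equivariant_map_fixed_identity\<close> excludes.\<close>

lemma equivariant_map_has_zero_on_sphere:
  fixes \<Psi> :: "'a::euclidean_space \<times> 'b::euclidean_space \<Rightarrow> 'a \<times> 'b"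
  assumes dim: "DIM('a) \<ge> 2" "DIM('b) \<ge> 2" and b0: "b0 \<in> Basis" and R: "R > 0"
    and cont: "continuous_on UNIV \<Psi>"
    and equiv: "\<And>a b. \<Psi> (a, - b) = (fst (\<Psi> (a, b)), - snd (\<Psi> (a, b)))"
    and b0_zero: "\<And>p. snd (\<Psi> p) \<bullet> b0 = 0"
    and hom: "homotopic_with_canon (\<lambda>_. True) (sphere 0 R) (- {0}) (\<lambda>a. fst (\<Psi> (a, 0))) id"
  obtains p where "norm p = R" "\<Psi> p = 0"
proof (rule ccontr)
  assume "\<not> thesis"
  with that have nz: "\<And>p. norm p = R \<Longrightarrow> \<Psi> p \<noteq> 0" by blast
  \<comment> \<open>\<open>q\<close> and \<open>k\<close> are dimensions of unit spheres, one less
    than those of the spaces, so the unit sphere of the product has dimension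
    \<open>q + 1 + k\<close>.\<close>
  define q where "q = DIM('a) - 1"
  define k where "k = DIM('b) - 1"
  have dims: "DIM('a) = Suc q" "DIM('b) = Suc k" "q > 0" "k > 0"
    using dim by (auto simp: q_def k_def)
  obtain \<alpha> :: "nat \<Rightarrow> 'a" where \<alpha>: "bij_betw \<alpha> {..<Suc q} Basis"
    using Basis_enumeration_last[OF SOME_Basis] dims by metis
  obtain \<beta> :: "nat \<Rightarrow> 'b" where \<beta>: "bij_betw \<beta> {..<Suc k} Basis" "\<beta> k = b0"
    using Basis_enumeration_last[OF b0] dims by (metis diff_Suc_1)
  \<comment> \<open>The first factor takes the indices 0 to \<open>q\<close>, the second the indices
    \<open>q + 1\<close> to \<open>q + 1 + k\<close>. The involution thereby becomes
    \<open>flip_from q\<close>, and the zero padding of \<open>coord\<close> matches that of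
    \<open>nsphere\<close>.\<close>
  define vec :: "(nat \<Rightarrow> real) \<Rightarrow> 'a \<times> 'b"
    where "vec x = (\<Sum>i<Suc q. x i *\<^sub>R \<alpha> i, \<Sum>j<Suc k. x (Suc q + j) *\<^sub>R \<beta> j)" for x
  define coord :: "'a \<times> 'b \<Rightarrow> nat \<Rightarrow> real"
    where "coord p i = (if i \<le> q then fst p \<bullet> \<alpha> i
       else if i \<le> q + 1 + k then snd p \<bullet> \<beta> (i - Suc q) else 0)" for p i
  have \<alpha>ip: "\<alpha> i \<bullet> \<alpha> j = (if i = j then 1 else 0)" if "i < Suc q" "j < Suc q" for i j
    using bij_betwE[OF \<alpha>] bij_betw_imp_inj_on[OF \<alpha>] that by (auto simp: inner_Basis inj_on_eq_iff)
  have \<beta>ip: "\<beta> i \<bullet> \<beta> j = (if i = j then 1 else 0)" if "i < Suc k" "j < Suc k" for i j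
    using bij_betwE[OF \<beta>(1)] bij_betw_imp_inj_on[OF \<beta>(1)] that by (auto simp: inner_Basis inj_on_eq_iff)
  have coord_vec: "coord (vec x) = x" if "\<forall>i > q + 1 + k. x i = 0" for x
  proof
    fix i
    consider "i \<le> q" | "q < i" "i \<le> q + 1 + k" | "i > q + 1 + k" by linarith
    then show "coord (vec x) i = x i"
    proof cases
      case 1
      have "(\<Sum>j<Suc q. x j *\<^sub>R \<alpha> j) \<bullet> \<alpha> i = (\<Sum>j<Suc q. if j = i then x j else 0)"
        unfolding inner_sum_left by (rule sum.cong) (use 1 \<alpha>ip in auto)
      with 1 show ?thesis by (simp add: coord_def vec_def del: sum.lessThan_Suc)
    next
      case 2
      have "(\<Sum>j<Suc k. x (Suc q + j) *\<^sub>R \<beta> j) \<bullet> \<beta> (i - Suc q)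
          = (\<Sum>j<Suc k. if j = i - Suc q then x (Suc q + j) else 0)"
        unfolding inner_sum_left by (rule sum.cong) (use 2 \<beta>ip in auto)
      with 2 show ?thesis by (auto simp: coord_def vec_def simp del: sum.lessThan_Suc)
    next
      case 3
      with that show ?thesis by (simp add: coord_def)
    qed
  qed
  have norm_coord: "(\<Sum>i\<le>q + 1 + k. (coord p i)\<^sup>2) = (norm p)\<^sup>2" for p
  proof -
    have split: "{..q + 1 + k} = {..<Suc q} \<union> (\<lambda>j. Suc q + j) ` {..<Suc k}"
      using image_add_atLeastLessThan[of "Suc q" 0 "Suc k"] by (auto simp: lessThan_atLeast0 simp del: image_add_atLeastLessThan image_add_atLeastLessThan')
    have "(\<Sum>i\<le>q + 1 + k. (coord p i)\<^sup>2)
        = (\<Sum>i<Suc q. (coord p i)\<^sup>2) + (\<Sum>i\<in>(\<lambda>j. Suc q + j) ` {..<Suc k}. (coord p i)\<^sup>2)"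
      unfolding split by (rule sum.union_disjoint) auto
    also have "(\<Sum>i\<in>(\<lambda>j. Suc q + j) ` {..<Suc k}. (coord p i)\<^sup>2) = (\<Sum>j<Suc k. (snd p \<bullet> \<beta> j)\<^sup>2)"
      by (subst sum.reindex) (auto simp: coord_def intro!: sum.cong)
    also have "\<dots> = (\<Sum>b\<in>Basis. (snd p \<bullet> b)\<^sup>2)"
      using \<beta>(1) by (rule sum.reindex_bij_betw)
    also have "(\<Sum>i<Suc q. (coord p i)\<^sup>2) = (\<Sum>i<Suc q. (fst p \<bullet> \<alpha> i)\<^sup>2)"
      by (rule sum.cong) (auto simp: coord_def)
    also have "\<dots> = (\<Sum>b\<in>Basis. (fst p \<bullet> b)\<^sup>2)"
      using \<alpha> by (rule sum.reindex_bij_betw)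
    finally show ?thesis
      unfolding power2_norm_eq_inner inner_prod_def euclidean_inner[of "fst p" "fst p"]
        euclidean_inner[of "snd p" "snd p"] by (simp add: power2_eq_square)
  qed
  have coord_zero: "coord p i = 0" if "i > q + 1 + k" for p i
    using that by (simp add: coord_def)
  have coord_b0: "coord p (q + 1 + k) = snd p \<bullet> b0" for p
    using \<beta>(2) by (simp add: coord_def)
  have cont_coord: "continuous_on S coord" for S
  proof (rule continuous_on_coordinatewise_then_product)
    show "continuous_on S (\<lambda>p. coord p i)" for i
      by (cases "i \<le> q"; cases "i \<le> q + 1 + k") (auto simp: coord_def intro!: continuous_intros)
  qed
  have cont_vec: "continuous_on S vec" for S
    unfolding vec_def
    by (intro continuous_intros) (auto intro: continuous_on_product_coordinates continuous_on_subset)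
  have vec_flip: "vec (flip_from q x) = (fst (vec x), - snd (vec x))" for x
    by (auto simp: vec_def flip_from_def sum_negf intro!: sum.cong simp del: sum.lessThan_Suc)
  have coord_flip: "coord (a, - b) = flip_from q (coord (a, b))" for a b
    by (auto simp: coord_def flip_from_def)
  have vec_norm: "norm (vec x) = 1" if "x \<in> topspace (nsphere (q + 1 + k))" for x
  proof -
    have "(norm (vec x))\<^sup>2 = 1"
      using that norm_coord[of "vec x"] coord_vec[of x] by (simp add: nsphere)
    then show ?thesis by (simp add: power2_eq_1_iff) (metis norm_ge_zero not_one_le_zero neg_0_le_iff_le)
  qed
  define N :: "'a \<times> 'b \<Rightarrow> 'a \<times> 'b" where "N p = p /\<^sub>R norm p" for p
  define \<phi> where "\<phi> x = coord (N (\<Psi> (R *\<^sub>R vec x)))" for x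
  have normN: "norm (N p) = 1" if "p \<noteq> 0" for p
    using that by (simp add: N_def)
  have \<Psi>nz: "\<Psi> (R *\<^sub>R vec x) \<noteq> 0" if "x \<in> topspace (nsphere (q + 1 + k))" for x
    using that R by (intro nz) (simp add: vec_norm)
  have target: "coord p \<in> topspace (nsphere (q + k))" if "norm p = 1" "snd p \<bullet> b0 = 0" for p
  proof -
    have "(\<Sum>i\<le>Suc (q + k). (coord p i)\<^sup>2) = 1"
      using norm_coord[of p] that by simp
    then have "(\<Sum>i\<le>q + k. (coord p i)\<^sup>2) = 1"
      using coord_b0[of p] that by simp
    moreover have "coord p i = 0" if "i > q + k" for i
      using that coord_zero[of i p] coord_b0[of p] \<open>snd p \<bullet> b0 = 0\<close> by (cases "i = q + 1 + k") auto
    ultimately show ?thesis by (simp add: nsphere)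
  qed
  have "continuous_map (nsphere (q + 1 + k)) (nsphere (q + k)) \<phi>"
  proof -
    have "continuous_on (topspace (nsphere (q + 1 + k))) \<phi>"
      unfolding \<phi>_def
      by (rule continuous_on_compose2[OF cont_coord])
        (use \<Psi>nz in \<open>auto simp: N_def intro!: continuous_intros continuous_on_compose2[OF cont] cont_vec\<close>)
    moreover have "\<phi> x \<in> topspace (nsphere (q + k))" if "x \<in> topspace (nsphere (q + 1 + k))" for x
      unfolding \<phi>_def using that normN[OF \<Psi>nz[OF that]] b0_zero by (intro target) (auto simp: N_def)
    ultimately show ?thesis
      by (auto simp: nsphere_eq_top_of_set)
  qed
  moreover have equiv': "\<Psi> (fst p, - snd p) = (fst (\<Psi> p), - snd (\<Psi> p))" for p
    using equiv[of "fst p" "snd p"] by simp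
  moreover have "\<phi> (flip_from q x) = flip_from q (\<phi> x)" for x
  proof -
    have "R *\<^sub>R vec (flip_from q x) = (fst (R *\<^sub>R vec x), - snd (R *\<^sub>R vec x))"
      by (simp add: vec_flip)
    then have "\<Psi> (R *\<^sub>R vec (flip_from q x)) = (fst (\<Psi> (R *\<^sub>R vec x)), - snd (\<Psi> (R *\<^sub>R vec x)))"
      by (simp only: equiv')
    then have "N (\<Psi> (R *\<^sub>R vec (flip_from q x))) = (fst (N (\<Psi> (R *\<^sub>R vec x))), - snd (N (\<Psi> (R *\<^sub>R vec x))))"
      by (simp add: N_def norm_prod_def)
    then show ?thesis
      using coord_flip[of "fst (N (\<Psi> (R *\<^sub>R vec x)))" "snd (N (\<Psi> (R *\<^sub>R vec x)))"] by (simp add: \<phi>_def)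
  qed
  moreover have "homotopic_with (\<lambda>_. True) (nsphere q) (nsphere q) \<phi> id"
  proof -
    \<comment> \<open>\<open>?g\<close> scales \<open>nsphere q\<close> up to radius
      \<open>R\<close> and \<open>?f\<close> projects radially back, so composing \<open>hom\<close>
      with both gives a homotopy on \<open>nsphere q\<close>.\<close>
    let ?f = "\<lambda>a. coord (a /\<^sub>R norm a, 0)" and ?g = "\<lambda>x. R *\<^sub>R fst (vec x)"
    have small: "x \<in> topspace (nsphere (q + 1 + k))" if "x \<in> topspace (nsphere q)" for x
    proof -
      have "(\<Sum>i\<le>q + 1 + k. (x i)\<^sup>2) = (\<Sum>i\<le>q. (x i)\<^sup>2)"
        using that by (intro sum.mono_neutral_right) (auto simp: nsphere)
      with that show ?thesis by (auto simp: nsphere)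
    qed
    have vec0: "vec x = (fst (vec x), 0)" if "x \<in> topspace (nsphere q)" for x
      using that by (simp add: vec_def nsphere del: sum.lessThan_Suc)
    have nfst: "norm (fst (vec x)) = 1" if "x \<in> topspace (nsphere q)" for x
      using vec_norm[OF small[OF that]] by (subst (asm) vec0[OF that]) (simp add: norm_Pair)
    have "continuous_map (nsphere q) (top_of_set (sphere 0 R)) ?g"
      using nfst R unfolding nsphere_eq_top_of_set
      by (auto intro!: continuous_intros cont_vec)
    moreover have "continuous_map (top_of_set (- {0})) (nsphere q) ?f"
    proof -
      have "?f a \<in> topspace (nsphere q)" if "a \<noteq> 0" for a
      proof -
        let ?p = "(a /\<^sub>R norm a, 0) :: 'a \<times> 'b"
        have z: "coord ?p i = 0" if "i > q" for i using that by (simp add: coord_def)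
        then have "(\<Sum>i\<le>q + 1 + k. (coord ?p i)\<^sup>2) = (\<Sum>i\<le>q. (coord ?p i)\<^sup>2)"
          by (intro sum.mono_neutral_right) auto
        then show ?thesis
          using norm_coord[of ?p] that z by (simp add: nsphere)
      qed
      moreover have "continuous_on (- {0}) ?f"
        by (rule continuous_on_compose2[OF cont_coord[of UNIV]]) (auto intro!: continuous_intros)
      ultimately show ?thesis
        by (auto simp: nsphere_eq_top_of_set)
    qed
    ultimately have *: "homotopic_with (\<lambda>_. True) (nsphere q) (nsphere q)
        (?f \<circ> (\<lambda>a. fst (\<Psi> (a, 0))) \<circ> ?g) (?f \<circ> id \<circ> ?g)"
      using homotopic_with_compose_continuous_map_right[OF
          homotopic_with_compose_continuous_map_left[OF hom, where q = "\<lambda>_. True"], where q = "\<lambda>_. True"]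
      by blast
    \<comment> \<open>At \<open>b = 0\<close> equivariance says that the second component equals its
      own negative.\<close>
    have snd0: "snd (\<Psi> (a, 0)) = 0" for a
      using equiv[of a 0] by (simp add: prod_eq_iff eq_neg_iff_add_eq_0 flip: scaleR_2)
    show ?thesis
    proof (rule homotopic_with_eq[OF *])
      fix x assume x: "x \<in> topspace (nsphere q)"
      have "\<Psi> (R *\<^sub>R vec x) = (fst (\<Psi> (R *\<^sub>R fst (vec x), 0)), 0)"
        using snd0 by (subst vec0[OF x]) (simp add: prod_eq_iff)
      then show "\<phi> x = (?f \<circ> (\<lambda>a. fst (\<Psi> (a, 0))) \<circ> ?g) x"
        by (simp add: \<phi>_def N_def)
      have "coord (fst (vec x), 0) = x"
        using vec0[OF x] coord_vec[of x] small[OF x] by (simp add: nsphere)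
      then show "id x = (?f \<circ> id \<circ> ?g) x"
        using nfst[OF x] R by simp
    qed auto
  qed
  ultimately show False
    using no_equivariant_map_fixed_identity[of q k \<phi>] dims by blast
qed

section \<open>Regular level sets\<close>

lemma smooth_fun_has_derivative_grad:
  fixes f :: "real^'n \<Rightarrow> real"
  assumes "smooth_fun f"
  shows "(f has_derivative (\<lambda>h. grad f x \<bullet> h)) (at x)"
proof -
  have d: "(f has_derivative frechet_derivative f (at x)) (at x)"
    using assms by (auto elim: smooth_fun.cases simp flip: frechet_derivative_works)
  then interpret linear "frechet_derivative f (at x)"
    by (rule has_derivative_linear)
  have "frechet_derivative f (at x) h = grad f x \<bullet> h" for h
  proof -
    have "frechet_derivative f (at x) h = frechet_derivative f (at x) (\<Sum>i\<in>UNIV. h $ i *\<^sub>R axis i 1)"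
      by (simp add: basis_expansion flip: scalar_mult_eq_scaleR)
    also have "\<dots> = grad f x \<bullet> h"
      by (simp add: sum scale grad_def inner_vec_def mult.commute)
    finally show ?thesis .
  qed
  then have "frechet_derivative f (at x) = (\<lambda>h. grad f x \<bullet> h)" by auto
  with d show ?thesis by metis
qed

text \<open>Two unfoldings of the coinductive predicate suffice: a partial derivative is again
  smooth, hence differentiable and continuous.\<close>

lemma smooth_fun_continuous_on_grad:
  fixes f :: "real^'n \<Rightarrow> real"
  assumes "smooth_fun f"
  shows "continuous_on S (grad f)"
proof -
  have "continuous_on S (\<lambda>x. frechet_derivative f (at x) (axis i 1))" for i
  proof -
    have "smooth_fun (\<lambda>x. frechet_derivative f (at x) (axis i 1))"
      using assms by (auto elim: smooth_fun.cases simp: axis_in_Basis_iff)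
    then have "\<forall>x. (\<lambda>x. frechet_derivative f (at x) (axis i 1)) differentiable (at x)"
      by (auto elim: smooth_fun.cases)
    then show ?thesis
      by (meson continuous_at_imp_continuous_on differentiable_imp_continuous_within)
  qed
  then show ?thesis
    unfolding grad_def by (intro continuous_on_vec_lambda) auto
qed

lemma smooth_fun_continuous_on:
  assumes "smooth_fun f"
  shows "continuous_on S f"
proof -
  have "\<forall>x. f differentiable (at x)"
    using assms by (auto elim: smooth_fun.cases)
  then show ?thesis
    by (meson continuous_at_imp_continuous_on differentiable_imp_continuous_within)
qed

text \<open>The gradient is uniformly continuous on the closed unit neighbourhood of
  \<open>K\<close>; the mean value inequality turns its small oscillation into the error
  bound.\<close>

lemma uniformly_differentiable_on_compact:
  fixes f :: "'a::euclidean_space \<Rightarrow> real" and f' :: "'a \<Rightarrow> 'a"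
  assumes der: "\<And>x. (f has_derivative (\<lambda>h. f' x \<bullet> h)) (at x)" and cont: "continuous_on UNIV f'"
    and K: "compact K" and e: "e > 0"
  obtains d where "d > 0"
    "\<And>p w. p \<in> K \<Longrightarrow> norm w \<le> d \<Longrightarrow> \<bar>f (p + w) - f p - f' p \<bullet> w\<bar> \<le> e * norm w"
proof -
  let ?L = "{x + y | x y. x \<in> K \<and> y \<in> cball 0 1}"
  have "uniformly_continuous_on ?L f'"
    using K by (intro compact_uniformly_continuous continuous_on_subset[OF cont] compact_sums) auto
  from this[unfolded uniformly_continuous_on_def, rule_format, OF e]
  obtain d where d: "d > 0" "\<And>x y. x \<in> ?L \<Longrightarrow> y \<in> ?L \<Longrightarrow> dist y x < d \<Longrightarrow> dist (f' y) (f' x) < e"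
    by blast
  show ?thesis
  proof
    \<comment> \<open>The half makes distances strictly less than \<open>d\<close>; the bound 1
      keeps \<open>p + w\<close> in \<open>?L\<close>.\<close>
    show "min (d / 2) 1 > 0" using d by simp
    fix p w :: 'a assume p: "p \<in> K" and w: "norm w \<le> min (d / 2) 1"
    let ?S = "cball p (norm w)"
    have inL: "x \<in> ?L" if "x \<in> ?S" for x
      using p w that by (intro CollectI exI[of _ p] exI[of _ "x - p"]) (auto simp: dist_norm norm_minus_commute)
    have "norm (f (p + w) - f p - f' p \<bullet> (p + w - p)) \<le> norm (p + w - p) * e"
    proof (rule differentiable_bound_linearization[of p "p + w" ?S f "\<lambda>x h. f' x \<bullet> h" p e])
      show "p + t *\<^sub>R (p + w - p) \<in> ?S" if "t \<in> {0..1}" for t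
        using that by (auto simp: dist_norm mult_left_le_one_le)
      show "(f has_derivative (\<lambda>h. f' x \<bullet> h)) (at x within ?S)" for x
        using der by (rule has_derivative_at_withinI)
      fix x assume x: "x \<in> ?S"
      have "dist x p < d"
        using x w d by (auto simp: dist_commute)
      then have "dist (f' x) (f' p) < e"
        using d(2)[of p x] inL[OF x] inL[of p] by simp
      then have "norm ((f' x - f' p) \<bullet> h) \<le> e * norm h" for h
        using Cauchy_Schwarz_ineq2[of "f' x - f' p" h]
          mult_right_mono[of "norm (f' x - f' p)" e "norm h"] by (simp add: dist_norm)
      then show "onorm ((\<lambda>h. f' x \<bullet> h) - (\<lambda>h. f' p \<bullet> h)) \<le> e"
        using e by (intro onorm_le) (auto simp: inner_diff_left)
    qed auto
    then show "\<bar>f (p + w) - f p - f' p \<bullet> w\<bar> \<le> e * norm w"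
      by (simp add: mult.commute)
  qed
qed

section \<open>Path connectedness of regular level sets\<close>

lemma dual_family_exists:
  fixes v :: "'i \<Rightarrow> 'a::euclidean_space"
  assumes "lin_indep_family v I"
  obtains d where "\<And>i j. i \<in> I \<Longrightarrow> j \<in> I \<Longrightarrow> v j \<bullet> d i = (if i = j then 1 else 0)"
proof -
  have ind: "independent (v ` I)" and inj: "inj_on v I"
    using assms by (auto simp: lin_indep_family_def)
  have "\<exists>f. linear f \<and> (\<forall>x\<in>v ` I. f x = (if x = v i then 1 else 0 :: real))" for i
    by (rule linear_independent_extend[OF ind])
  then obtain f where f: "\<And>i. linear (f i)" "\<And>i x. x \<in> v ` I \<Longrightarrow> f i x = (if x = v i then 1 else 0 :: real)"
    by metis
  \<comment> \<open>The adjoint of a real functional, applied to 1, is the vector that represents it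
    by the inner product.\<close>
  have "v j \<bullet> adjoint (f i) 1 = (if i = j then 1 else 0)" if "i \<in> I" "j \<in> I" for i j
    using adjoint_works[OF f(1), of "v j" i 1] f(2)[of "v j" i] inj that by (auto simp: inj_on_eq_iff)
  then show ?thesis
    by (rule that)
qed

text \<open>With \<open>d\<close> dual to the gradients at \<open>p\<close>, the map
  \<open>x \<mapsto> x - p + (\<Sum>i. (g i x - c i - v i \<bullet> (x - p)) d i)\<close> has identity derivative at \<open>p\<close> and
  straightens the level set to a linear subspace.\<close>

lemma regular_level_set_locally_path_connected:
  fixes g :: "'i \<Rightarrow> 'a::euclidean_space \<Rightarrow> real"
  assumes fin: "finite I"
    and der: "\<And>i x. i \<in> I \<Longrightarrow> (g i has_derivative (\<lambda>h. dg i x \<bullet> h)) (at x)"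
    and cont: "\<And>i. i \<in> I \<Longrightarrow> continuous_on UNIV (dg i)"
    and p: "\<forall>i\<in>I. g i p = c i" and ind: "lin_indep_family (\<lambda>i. dg i p) I"
  obtains N where "openin (top_of_set {x. \<forall>i\<in>I. g i x = c i}) N" "p \<in> N" "path_connected N"
proof -
  define v where "v i = dg i p" for i
  obtain d where d: "\<And>i j. i \<in> I \<Longrightarrow> j \<in> I \<Longrightarrow> v j \<bullet> d i = (if i = j then 1 else 0)"
    using dual_family_exists[OF ind] unfolding v_def by blast
  define H where "H x = x - p + (\<Sum>i\<in>I. (g i x - c i - v i \<bullet> (x - p)) *\<^sub>R d i)" for x
  define H' where "H' x = Blinfun (\<lambda>h. h + (\<Sum>i\<in>I. (dg i x \<bullet> h - v i \<bullet> h) *\<^sub>R d i))" for x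
  have H'_apply: "blinfun_apply (H' x) = (\<lambda>h. h + (\<Sum>i\<in>I. (dg i x \<bullet> h - v i \<bullet> h) *\<^sub>R d i))" for x
    unfolding H'_def
    by (intro bounded_linear_Blinfun_apply bounded_linear_add bounded_linear_sum bounded_linear_ident
        bounded_linear_scaleR_const bounded_linear_sub bounded_linear_inner_right)
  have derH: "(H has_derivative blinfun_apply (H' x)) (at x)" for x
    unfolding H_def H'_apply
    by (auto intro!: derivative_eq_intros der simp: fun_eq_iff)
  have contH: "continuous_on UNIV H'"
    by (intro continuous_on_blinfun_componentwise)
       (auto simp: H'_apply intro!: continuous_intros cont)
  have H'p: "id_blinfun o\<^sub>L H' p = id_blinfun"
    by (rule blinfun_eqI) (simp add: H'_apply v_def)
  have Hp: "H p = 0"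
    using p by (simp add: H_def)
  \<comment> \<open>By duality the linear terms cancel, so within \<open>U\<close> the level set is
    the preimage under \<open>H\<close> of the subspace orthogonal to all \<open>v j\<close>. A ball
    in that subspace is convex, and its image under \<open>k\<close> is the required
    neighbourhood.\<close>
  have vH: "v j \<bullet> H x = g j x - c j" if "j \<in> I" for j x
  proof -
    have "v j \<bullet> H x = v j \<bullet> (x - p) + (\<Sum>i\<in>I. (g i x - c i - v i \<bullet> (x - p)) * (v j \<bullet> d i))"
      by (simp add: H_def inner_add_right inner_sum_right)
    also have "(\<Sum>i\<in>I. (g i x - c i - v i \<bullet> (x - p)) * (v j \<bullet> d i))
        = (\<Sum>i\<in>I. if i = j then g i x - c i - v i \<bullet> (x - p) else 0)"
      by (rule sum.cong) (use d that in auto)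
    finally show ?thesis
      using fin that by simp
  qed
  obtain U V k where U: "open U" "p \<in> U" and V: "open V" "H p \<in> V" and hom: "homeomorphism U V H k"
    by (rule inverse_function_theorem[OF open_UNIV derH contH UNIV_I H'p])
  obtain e where e: "e > 0" "ball 0 e \<subseteq> V"
    using V Hp by (auto simp: open_contains_ball)
  define W where "W = ball 0 e \<inter> {y. \<forall>j\<in>I. v j \<bullet> y = 0}"
  have "convex W"
    unfolding W_def by (intro convex_Int convex_ball) (auto simp: convex_def inner_add_right)
  then have "path_connected (k ` W)"
    using hom e by (intro path_connected_continuous_image convex_imp_path_connected)
      (auto simp: W_def homeomorphism_def elim: continuous_on_subset)
  moreover have kW: "k ` W = {x. \<forall>i\<in>I. g i x = c i} \<inter> (U \<inter> H -` ball 0 e)"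
  proof (intro equalityI subsetI)
    fix x assume "x \<in> k ` W"
    then obtain y where y: "y \<in> W" "x = k y" by blast
    then have "x \<in> U" "H x = y"
      using hom e by (auto simp: W_def homeomorphism_def)
    then show "x \<in> {x. \<forall>i\<in>I. g i x = c i} \<inter> (U \<inter> H -` ball 0 e)"
      using y vH[of _ x] by (auto simp: W_def)
  next
    fix x assume x: "x \<in> {x. \<forall>i\<in>I. g i x = c i} \<inter> (U \<inter> H -` ball 0 e)"
    then have "H x \<in> W" "x = k (H x)"
      using hom vH by (auto simp: W_def homeomorphism_def)
    then show "x \<in> k ` W" by blast
  qed
  have "open (U \<inter> H -` ball 0 e)"
    using U derH by (intro open_Int open_vimage open_ball continuous_at_imp_continuous_on)
      (auto intro: has_derivative_continuous)
  then have "openin (top_of_set {x. \<forall>i\<in>I. g i x = c i}) (k ` W)"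
    unfolding kW by (rule openin_open_Int)
  moreover have "p \<in> {x. \<forall>i\<in>I. g i x = c i} \<inter> (U \<inter> H -` ball 0 e)"
    using p U Hp e by simp
  ultimately show ?thesis
    using that[of "k ` W"] kW by simp
qed

text \<open>Every point has a path connected relative neighbourhood, so the path components are
  relatively open, and a connected set has only one.\<close>

lemma connected_regular_level_set_path_connected:
  fixes g :: "'i \<Rightarrow> 'a::euclidean_space \<Rightarrow> real"
  assumes fin: "finite I"
    and der: "\<And>i x. i \<in> I \<Longrightarrow> (g i has_derivative (\<lambda>h. dg i x \<bullet> h)) (at x)"
    and cont: "\<And>i. i \<in> I \<Longrightarrow> continuous_on UNIV (dg i)"
    and Y: "Y = {x. \<forall>i\<in>I. g i x = c i}"
    and ind: "\<And>p. p \<in> Y \<Longrightarrow> lin_indep_family (\<lambda>i. dg i p) I"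
    and "connected Y"
  shows "path_connected Y"
  unfolding path_connected_component
proof (intro ballI)
  fix a b assume ab: "a \<in> Y" "b \<in> Y"
  show "path_component Y a b"
  proof (rule connected_equivalence_relation[OF \<open>connected Y\<close> ab])
    fix p assume p: "p \<in> Y"
    then have "\<forall>i\<in>I. g i p = c i"
      by (simp add: Y)
    note loc = regular_level_set_locally_path_connected[where g = g and dg = dg and c = c and p = p and I = I,
        OF fin der cont this ind[OF p], folded Y]
    obtain N where N: "openin (top_of_set Y) N" "p \<in> N" "path_connected N"
      by (rule loc)
    have "path_component Y p x" if "x \<in> N" for x
    proof -
      have "path_component N p x"
        using N that by (simp add: path_connected_component)
      then show ?thesis
        using openin_imp_subset[OF N(1)] path_component_of_subset by blast
    qed
    with N show "\<exists>T. openin (top_of_set Y) T \<and> p \<in> T \<and> (\<forall>x\<in>T. path_component Y p x)"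
      by auto
  qed (blast intro: path_component_sym path_component_trans)+
qed

text \<open>The norm of the combination is continuous and nonzero on \<open>K\<close> times the unit
  sphere of coefficient vectors; its minimum is \<open>a\<close>, and homogeneity covers all
  \<open>s\<close>. The coefficient of \<open>v i\<close> is stored in coordinate
  \<open>e i\<close>.\<close>

lemma uniformly_independent_on_compact:
  fixes v :: "'i \<Rightarrow> 'a::euclidean_space \<Rightarrow> 'a" and e :: "'i \<Rightarrow> 'n::finite"
  assumes fin: "finite I" and inj: "inj_on e I" and K: "compact K"
    and cont: "\<And>i. i \<in> I \<Longrightarrow> continuous_on K (v i)"
    and ind: "\<And>p. p \<in> K \<Longrightarrow> lin_indep_family (\<lambda>i. v i p) I"
  obtains a where "a > 0" "\<And>p s. p \<in> K \<Longrightarrow> (\<And>j. j \<notin> e ` I \<Longrightarrow> s $ j = 0) \<Longrightarrow>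
      a * norm (s :: real^'n) \<le> norm (\<Sum>i\<in>I. s $ e i *\<^sub>R v i p)"
proof -
  define W where "W p s = (\<Sum>i\<in>I. s $ e i *\<^sub>R v i p)" for p and s :: "real^'n"
  define S where "S = sphere (0 :: real^'n) 1 \<inter> {s. \<forall>j\<in>- (e ` I). s $ j = 0}"
  have W_nz: "W p s \<noteq> 0" if p: "p \<in> K" and s: "s \<in> S" for p s
  proof
    assume 0: "W p s = 0"
    have inj': "inj_on (\<lambda>i. v i p) I" and indep: "independent ((\<lambda>i. v i p) ` I)"
      using ind[OF p] by (auto simp: lin_indep_family_def)
    have inv: "the_inv_into I (\<lambda>i. v i p) (v i p) = i" if "i \<in> I" for i
      using the_inv_into_f_f[OF inj' that] .
    define u where "u x = s $ e (the_inv_into I (\<lambda>i. v i p) x)" for x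
    have "(\<Sum>x\<in>(\<lambda>i. v i p) ` I. u x *\<^sub>R x) = W p s"
      unfolding W_def using inj' by (subst sum.reindex) (auto simp: u_def inv intro!: sum.cong)
    then have "\<forall>x\<in>(\<lambda>i. v i p) ` I. u x = 0"
      using indep fin 0 by (auto simp: independent_explicit_finite_subsets dependent_finite)
    then have "s $ e i = 0" if "i \<in> I" for i
      using that by (auto simp: u_def inv)
    then have "s = 0"
      using s by (auto simp: S_def vec_eq_iff)
    with s show False by (simp add: S_def)
  qed
  have "closed {s :: real^'n. \<forall>j\<in>- (e ` I). s $ j = 0}"
    unfolding Collect_ball_eq by (intro closed_INT ballI closed_Collect_eq continuous_intros)
  then have "compact S"
    unfolding S_def by (intro compact_Int_closed) auto
  then have comp: "compact (K \<times> S)"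
    using K by (rule compact_Times[rotated])
  have contW: "continuous_on (K \<times> S) (\<lambda>(p, s). norm (W p s))"
    unfolding W_def case_prod_unfold
    by (intro continuous_intros continuous_on_compose2[OF cont]) auto
  have "\<exists>a>0. \<forall>p\<in>K. \<forall>s\<in>S. a \<le> norm (W p s)"
  proof (cases "K \<times> S = {}")
    case True
    then show ?thesis by (intro exI[of _ 1]) auto
  next
    case False
    then obtain z where z: "z \<in> K \<times> S" "\<forall>y\<in>K \<times> S. (case z of (p, s) \<Rightarrow> norm (W p s)) \<le> (case y of (p, s) \<Rightarrow> norm (W p s))"
      using continuous_attains_inf[OF comp _ contW] by blast
    then show ?thesis
      using W_nz by (intro exI[of _ "case z of (p, s) \<Rightarrow> norm (W p s)"]) auto
  qed
  then obtain a where a: "a > 0" "\<And>p s. p \<in> K \<Longrightarrow> s \<in> S \<Longrightarrow> a \<le> norm (W p s)" by blast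
  have "a * norm s \<le> norm (\<Sum>i\<in>I. s $ e i *\<^sub>R v i p)"
    if p: "p \<in> K" and s: "\<And>j. j \<notin> e ` I \<Longrightarrow> s $ j = 0" for p and s :: "real^'n"
  proof (cases "s = 0")
    case False
    have "W p (s /\<^sub>R norm s) = W p s /\<^sub>R norm s"
      by (simp add: W_def scaleR_sum_right)
    moreover have "s /\<^sub>R norm s \<in> S"
      using s False by (simp add: S_def)
    ultimately have "a \<le> norm (W p s) / norm s"
      using a(2)[OF p, of "s /\<^sub>R norm s"] by (simp add: divide_inverse_commute)
    then show ?thesis
      using False by (simp add: W_def field_simps)
  qed simp
  with a(1) show ?thesis by (rule that)
qed

text \<open>To first order, \<open>\<Sum>i. s\<^sub>i (g i (p + w) - c i)\<close> with \<open>w = \<Sum>i. s\<^sub>i v i p\<close> is the squared norm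
  of \<open>w\<close>, so a small normal displacement is never orthogonal to the induced change of the \<open>g i\<close>.\<close>

lemma normal_displacement_positive:
  fixes g :: "'i \<Rightarrow> 'a::euclidean_space \<Rightarrow> real" and e :: "'i \<Rightarrow> 'n::finite"
  assumes fin: "finite I" and inj: "inj_on e I" and K: "compact K"
    and der: "\<And>i x. i \<in> I \<Longrightarrow> (g i has_derivative (\<lambda>h. v i x \<bullet> h)) (at x)"
    and cont: "\<And>i. i \<in> I \<Longrightarrow> continuous_on UNIV (v i)"
    and ind: "\<And>p. p \<in> K \<Longrightarrow> lin_indep_family (\<lambda>i. v i p) I"
    and level: "\<And>p i. p \<in> K \<Longrightarrow> i \<in> I \<Longrightarrow> g i p = c i"
  obtains r where "r > 0" "\<And>p s. p \<in> K \<Longrightarrow> (\<And>j. j \<notin> e ` I \<Longrightarrow> s $ j = 0) \<Longrightarrow>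
      (\<And>j. \<bar>s $ j\<bar> \<le> r) \<Longrightarrow> s \<noteq> (0 :: real^'n) \<Longrightarrow>
      (\<Sum>i\<in>I. s $ e i * (g i (p + (\<Sum>i\<in>I. s $ e i *\<^sub>R v i p)) - c i)) > 0"
proof -
  define W where "W p s = (\<Sum>i\<in>I. s $ e i *\<^sub>R v i p)" for p and s :: "real^'n"
  obtain a where a: "a > 0" "\<And>p s. p \<in> K \<Longrightarrow> (\<And>j. j \<notin> e ` I \<Longrightarrow> s $ j = 0) \<Longrightarrow> a * norm s \<le> norm (W p s)"
    using uniformly_independent_on_compact[where v = v and I = I and e = e and K = K, OF fin inj K _ ind]
      continuous_on_subset[OF cont] unfolding W_def by (metis subset_UNIV)
  \<comment> \<open>With \<open>eps = a / (2 * A)\<close> the linearisation errors add up to at most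
    half of \<open>(norm w)\<^sup>2\<close>. The summand 1 keeps \<open>A\<close> positive for empty
    \<open>I\<close>.\<close>
  define A where "A = real (card I) + 1"
  have A: "A > 0" by (simp add: A_def add_nonneg_pos)
  define eps where "eps = a / (2 * A)"
  have eps: "eps > 0" using a A by (simp add: eps_def)
  have "\<exists>d>0. \<forall>p\<in>K. \<forall>w. norm w \<le> d \<longrightarrow> \<bar>g i (p + w) - g i p - v i p \<bullet> w\<bar> \<le> eps * norm w" if "i \<in> I" for i
    using uniformly_differentiable_on_compact[OF der[OF that] cont[OF that] K eps] by metis
  then obtain \<eta> where \<eta>: "\<And>i. i \<in> I \<Longrightarrow> \<eta> i > 0"
    "\<And>i p w. i \<in> I \<Longrightarrow> p \<in> K \<Longrightarrow> norm w \<le> \<eta> i \<Longrightarrow> \<bar>g i (p + w) - g i p - v i p \<bullet> w\<bar> \<le> eps * norm w"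
    by metis
  have "\<exists>B. \<forall>p\<in>K. norm (v i p) \<le> B" if "i \<in> I" for i
  proof -
    have "compact (v i ` K)"
      using K continuous_on_subset[OF cont[OF that]] by (intro compact_continuous_image) auto
    from compact_imp_bounded[OF this] show ?thesis
      by (auto simp: bounded_iff)
  qed
  then obtain B where B: "\<And>i p. i \<in> I \<Longrightarrow> p \<in> K \<Longrightarrow> norm (v i p) \<le> B i"
    by metis
  have B': "norm (v i p) \<le> \<bar>B i\<bar>" if "i \<in> I" "p \<in> K" for i p
    using B[OF that] by linarith
  \<comment> \<open>Coefficients bounded by \<open>h / D\<close> give \<open>norm w \<le> h\<close>,
    the range in which all the linear approximations hold.\<close>
  define D where "D = 1 + (\<Sum>i\<in>I. \<bar>B i\<bar>)"
  have D: "D > 0" by (simp add: D_def add_pos_nonneg sum_nonneg)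
  define h where "h = Min (insert 1 (\<eta> ` I))"
  have h: "h > 0" "\<And>i. i \<in> I \<Longrightarrow> h \<le> \<eta> i"
    using fin \<eta>(1) by (auto simp: h_def)
  show ?thesis
  proof
    show "h / D > 0" using h D by simp
    fix p and s :: "real^'n"
    assume p: "p \<in> K" and s0: "\<And>j. j \<notin> e ` I \<Longrightarrow> s $ j = 0" and sr: "\<And>j. \<bar>s $ j\<bar> \<le> h / D" and "s \<noteq> 0"
    define w where "w = W p s"
    have "norm w \<le> (\<Sum>i\<in>I. \<bar>s $ e i\<bar> * norm (v i p))"
      unfolding w_def W_def by (rule order_trans[OF norm_sum]) simp
    also have "\<dots> \<le> (\<Sum>i\<in>I. h / D * \<bar>B i\<bar>)"
      using sr B'[OF _ p] h D by (intro sum_mono mult_mono) auto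
    also have "\<dots> \<le> h / D * D"
      unfolding sum_distrib_left[symmetric] using h D by (intro mult_left_mono) (auto simp: D_def)
    finally have wh: "norm w \<le> h" using D by simp
    have aw: "a * norm s \<le> norm w" unfolding w_def using p s0 by (rule a(2))
    then have w0: "norm w > 0"
      using a(1) \<open>s \<noteq> 0\<close> by (smt (verit) mult_pos_pos zero_less_norm_iff)
    have err: "s $ e i * (v i p \<bullet> w) - norm s * (eps * norm w) \<le> s $ e i * (g i (p + w) - c i)" if i: "i \<in> I" for i
    proof -
      have "\<bar>g i (p + w) - g i p - v i p \<bullet> w\<bar> \<le> eps * norm w"
        using \<eta>(2)[OF i p] h(2)[OF i] wh by simp
      then have "\<bar>s $ e i * (g i (p + w) - g i p - v i p \<bullet> w)\<bar> \<le> norm s * (eps * norm w)"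
        unfolding abs_mult using component_le_norm_cart[of s "e i"] by (intro mult_mono) auto
      then show ?thesis
        using level[OF p i] by (simp add: abs_le_iff algebra_simps)
    qed
    have "(\<Sum>i\<in>I. s $ e i * (v i p \<bullet> w)) = (norm w)\<^sup>2"
      by (simp add: power2_norm_eq_inner w_def W_def inner_sum_left)
    moreover have "real (card I) * (norm s * (eps * norm w)) \<le> A * (norm s * (eps * norm w))"
      using eps by (intro mult_right_mono) (auto simp: A_def)
    moreover have "A * (norm s * (eps * norm w)) = (a * norm s) * norm w / 2"
      using A by (simp add: eps_def)
    moreover have "(a * norm s) * norm w \<le> (norm w)\<^sup>2"
      using aw by (simp add: power2_eq_square mult_right_mono)
    moreover have "(\<Sum>i\<in>I. s $ e i * (v i p \<bullet> w) - norm s * (eps * norm w)) \<le> (\<Sum>i\<in>I. s $ e i * (g i (p + w) - c i))"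
      using err by (rule sum_mono)
    moreover have "(norm w)\<^sup>2 > 0" using w0 by simp
    ultimately have "(\<Sum>i\<in>I. s $ e i * (g i (p + w) - c i)) > 0"
      unfolding sum_subtractf sum_constant by linarith
    then show "(\<Sum>i\<in>I. s $ e i * (g i (p + (\<Sum>i\<in>I. s $ e i *\<^sub>R v i p)) - c i)) > 0"
      by (simp add: w_def W_def)
  qed
qed

section \<open>The social choice problem\<close>

text \<open>Dugundji's theorem extends the choice function from the closed set
  \<open>X \<times> X\<close>, with values in the ambient space. Averaging over the exchange of
  arguments makes it symmetric and, by anonymity, keeps its values on
  \<open>X \<times> X\<close>.\<close>

lemma two_agent_SCF_symmetric_extension:
  fixes X :: "'a::euclidean_space set"
  assumes X: "closed X" and F: "is_SCF 2 X F"
  obtains G where "continuous_on UNIV G" "\<forall>x y. G (x, y) = G (y, x)"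
    "\<forall>x\<in>X. \<forall>y\<in>X. G (x, y) \<in> X" "\<forall>x\<in>X. G (x, x) = x"
proof -
  define pr where "pr = (\<lambda>(x, y). \<lambda>i\<in>{..<2::nat}. if i = 0 then x else y :: 'a)"
  have pr: "pr (x, y) \<in> PiE {..<2} (\<lambda>_. X)" if "x \<in> X" "y \<in> X" for x y
    using that by (auto simp: pr_def)
  have "continuous_on S pr" for S
  proof (rule continuous_on_coordinatewise_then_product)
    show "continuous_on S (\<lambda>z. pr z i)" for i
      by (cases "i < 2"; cases "i = 0")
        (auto simp: pr_def case_prod_unfold intro!: continuous_intros)
  qed
  then have contF: "continuous_on (X \<times> X) (F \<circ> pr)"
    using F pr by (intro continuous_on_compose) (auto simp: is_SCF_def elim!: continuous_on_subset)
  have sym: "F (pr (x, y)) = F (pr (y, x))" if "x \<in> X" "y \<in> X" for x y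
  proof -
    have "pr (x, y) \<circ> Transposition.transpose 0 1 = pr (y, x)"
      by (auto simp: pr_def fun_eq_iff Transposition.transpose_def)
    moreover have "Transposition.transpose 0 1 permutes {..<2::nat}"
      by (rule permutes_swap_id) auto
    ultimately show ?thesis
      using F pr[OF that] unfolding is_SCF_def by metis
  qed
  have diag: "F (pr (x, x)) = x" if "x \<in> X" for x
  proof -
    have "pr (x, x) = (\<lambda>i\<in>{..<2}. x)"
      by (auto simp: pr_def fun_eq_iff)
    then show ?thesis
      using F that by (simp add: is_SCF_def)
  qed
  have inX: "F (pr (x, y)) \<in> X" if "x \<in> X" "y \<in> X" for x y
    using F pr[OF that] by (auto simp: is_SCF_def)
  have "closedin (top_of_set UNIV) (X \<times> X)"
    using X by (simp add: closed_Times)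
  then obtain H where H: "continuous_on UNIV H" "\<And>z. z \<in> X \<times> X \<Longrightarrow> H z = (F \<circ> pr) z"
    using Dugundji[of UNIV UNIV "X \<times> X" "F \<circ> pr"] contF by (metis UNIV_not_empty convex_UNIV top_greatest)
  define G where "G z = (1/2) *\<^sub>R (H z + H (snd z, fst z))" for z
  have G: "G (x, y) = F (pr (x, y))" if "x \<in> X" "y \<in> X" for x y
    using that sym[OF that] by (simp add: G_def H flip: scaleR_2)
  show ?thesis
  proof
    show "continuous_on UNIV G"
      unfolding G_def
      by (intro continuous_intros H(1) continuous_on_compose2[OF H(1)]) auto
    show "\<forall>x y. G (x, y) = G (y, x)"
      by (simp add: G_def add.commute)
  qed (use G inX diag in auto)
qed

text \<open>An \<open>m\<close>-cube crossing \<open>X\<close> once: the coordinate \<open>e m\<close> runs along a path in \<open>Y\<close>, the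
  coordinates \<open>e i\<close> with \<open>i < m\<close> run in the normal directions \<open>grad (g i)\<close>. The conclusion says that
  \<open>s \<mapsto> (g i (\<delta> s) - c i)\<^sub>i\<close> is linearly homotopic to the projection on these coordinates, with all
  zeros confined to a bounded set.\<close>

lemma crossing_cube_exists:
  fixes g :: "nat \<Rightarrow> real^'n \<Rightarrow> real" and e :: "nat \<Rightarrow> 'n"
  assumes m: "1 \<le> m" and e: "inj_on e {1..m}"
    and smooth: "\<And>i. i \<in> {1..m} \<Longrightarrow> smooth_fun (g i)"
    and Y: "Y = {p. \<forall>i\<in>{1..m-1}. g i p = c i}" and "connected Y"
    and ind: "\<And>p. p \<in> Y \<Longrightarrow> lin_indep_family (\<lambda>i. grad (g i) p) {1..m-1}"
    and a: "a \<in> Y" "g m a < c m" and b: "b \<in> Y" "c m < g m b"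
  obtains \<delta> :: "real^'n \<Rightarrow> real^'n" where "continuous_on UNIV \<delta>"
    "\<forall>s. \<forall>t\<in>{0..1}. (\<forall>i\<in>{1..m}. (1 - t) * (g i (\<delta> s) - c i) + t * s $ e i = 0) \<longrightarrow>
       (\<forall>i\<in>{1..m-1}. s $ e i = 0) \<and> \<bar>s $ e m\<bar> < 1"
proof -
  let ?I = "{1..m-1}"
  have injI: "inj_on e ?I"
    using e by (rule inj_on_subset) auto
  have der: "(g i has_derivative (\<lambda>h. grad (g i) x \<bullet> h)) (at x)" if "i \<in> ?I" for i x
    using that by (intro smooth_fun_has_derivative_grad smooth) auto
  have cont: "continuous_on S (grad (g i))" if "i \<in> ?I" for i S
    using that by (intro smooth_fun_continuous_on_grad smooth) auto
  have "path_connected Y"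
    using connected_regular_level_set_path_connected[where g = g and dg = "\<lambda>i. grad (g i)" and I = ?I and c = c,
        OF _ der cont Y ind \<open>connected Y\<close>] by simp
  then obtain \<gamma> where \<gamma>: "path \<gamma>" "path_image \<gamma> \<subseteq> Y" "pathstart \<gamma> = a" "pathfinish \<gamma> = b"
    using a(1) b(1) unfolding path_connected_def by blast
  define K where "K = path_image \<gamma>"
  have K: "compact K" "K \<subseteq> Y"
    using \<gamma> by (auto simp: K_def compact_path_image)
  obtain r where r: "r > 0" "\<And>p s. p \<in> K \<Longrightarrow> (\<And>j. j \<notin> e ` ?I \<Longrightarrow> s $ j = 0) \<Longrightarrow>
      (\<And>j. \<bar>s $ j\<bar> \<le> r) \<Longrightarrow> s \<noteq> (0 :: real^'n) \<Longrightarrow>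
      (\<Sum>i\<in>?I. s $ e i * (g i (p + (\<Sum>i\<in>?I. s $ e i *\<^sub>R grad (g i) p)) - c i)) > 0"
  proof (rule normal_displacement_positive[where g = g and v = "\<lambda>i. grad (g i)" and I = ?I and c = c and e = e and K = K])
    show "lin_indep_family (\<lambda>i. grad (g i) p) ?I" if "p \<in> K" for p
      using that K ind by auto
    show "g i p = c i" if "p \<in> K" "i \<in> ?I" for p i
      using that K Y by auto
  qed (use injI K der cont in auto)
  \<comment> \<open>The path is reparametrised over \<open>[-1, 1]\<close> and stays at
    \<open>a\<close> or \<open>b\<close> beyond. Likewise \<open>\<rho>\<close> clamps the normal
    coordinates to the range where the displacement estimate holds, so \<open>\<delta>\<close> is
    defined everywhere.\<close>
  define \<gamma>' where "\<gamma>' t = \<gamma> (max 0 (min 1 ((t + 1) / 2)))" for t :: real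
  define \<rho> where "\<rho> s = (\<chi> j. if j \<in> e ` ?I then max (- r) (min r (s $ j)) else 0)" for s :: "real^'n"
  define \<delta> where "\<delta> s = \<gamma>' (s $ e m) + (\<Sum>i\<in>?I. \<rho> s $ e i *\<^sub>R grad (g i) (\<gamma>' (s $ e m)))" for s
  have \<gamma>'K: "\<gamma>' t \<in> K" for t
    by (auto simp: \<gamma>'_def K_def path_image_def)
  have cont_\<gamma>': "continuous_on S \<gamma>'" for S
    unfolding \<gamma>'_def
    by (rule continuous_on_compose2[of "{0..1}" \<gamma>])
      (use \<gamma>(1) in \<open>auto simp: path_def intro!: continuous_intros\<close>)
  show ?thesis
  proof
    have "continuous_on UNIV (\<lambda>s. \<rho> s $ j)" for j
      by (cases "j \<in> e ` ?I") (auto simp: \<rho>_def intro!: continuous_intros)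
    then have "continuous_on UNIV (\<lambda>s. \<chi> j. \<rho> s $ j)"
      by (rule continuous_on_vec_lambda)
    then have "continuous_on UNIV \<rho>"
      by simp
    then show "continuous_on UNIV \<delta>"
      unfolding \<delta>_def
      by (intro continuous_intros continuous_on_compose2[OF cont_\<gamma>'[of UNIV]] continuous_on_compose2[OF cont[of _ UNIV]]) auto
    have "(\<forall>i\<in>?I. s $ e i = 0) \<and> \<bar>s $ e m\<bar> < 1"
      if t: "0 \<le> t" "t \<le> 1" and eq0: "\<forall>i\<in>{1..m}. (1 - t) * (g i (\<delta> s) - c i) + t * s $ e i = 0"
      for s t
    proof -
      note eq = bspec[OF eq0]
      \<comment> \<open>The equations are paired with \<open>\<rho> s\<close>. If it were nonzero,
        both parts of the convex combination would be positive: the first by the choice of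
        \<open>r\<close>, the second because clamping preserves signs.\<close>
      have \<rho>0: "\<rho> s = 0"
      proof (rule ccontr)
        assume nz: "\<rho> s \<noteq> 0"
        have "(\<Sum>i\<in>?I. \<rho> s $ e i * (g i (\<delta> s) - c i)) > 0"
          unfolding \<delta>_def by (rule r(2)[OF \<gamma>'K]) (use nz r(1) in \<open>auto simp: \<rho>_def\<close>)
        moreover have "(\<Sum>i\<in>?I. \<rho> s $ e i * s $ e i) > 0"
        proof -
          have nn: "\<rho> s $ e i * s $ e i \<ge> 0" if "i \<in> ?I" for i
            using that r(1) by (auto simp: \<rho>_def max_def min_def zero_le_mult_iff)
          obtain j where j: "\<rho> s $ j \<noteq> 0"
            using nz by (auto simp: vec_eq_iff)
          then obtain i where i: "i \<in> ?I" "j = e i"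
            by (auto simp: \<rho>_def split: if_splits)
          have "\<rho> s $ e i * s $ e i > 0"
            using j i r(1) by (auto simp: \<rho>_def max_def min_def zero_less_mult_iff split: if_splits)
          then show ?thesis
            using i nn by (intro sum_pos2[of _ i]) auto
        qed
        moreover have "(1 - t) * (\<Sum>i\<in>?I. \<rho> s $ e i * (g i (\<delta> s) - c i)) + t * (\<Sum>i\<in>?I. \<rho> s $ e i * s $ e i)
            = (\<Sum>i\<in>?I. \<rho> s $ e i * ((1 - t) * (g i (\<delta> s) - c i) + t * s $ e i))"
          unfolding sum_distrib_left sum.distrib[symmetric] by (rule sum.cong) (auto simp: algebra_simps)
        moreover have "\<dots> = 0"
          using eq by (intro sum.neutral) auto
        ultimately show False
          using t by (smt (verit) mult_nonneg_nonneg mult_pos_pos)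
      qed
      have "s $ e i = 0" if "i \<in> ?I" for i
      proof -
        have "\<rho> s $ e i = 0" using \<rho>0 by simp
        then show ?thesis using that r(1) by (auto simp: \<rho>_def max_def min_def split: if_splits)
      qed
      moreover have \<delta>: "\<delta> s = \<gamma>' (s $ e m)"
        by (simp add: \<delta>_def \<rho>0)
      \<comment> \<open>For \<open>s $ e m\<close> at least 1 or at most -1 the path is at an
        endpoint, where \<open>g m - c m\<close> has the same sign as \<open>s $ e m\<close>; the
        combination then cannot vanish.\<close>
      have eqm: "(1 - t) * (g m (\<gamma>' (s $ e m)) - c m) + t * s $ e m = 0"
        using eq[of m] m \<delta> by simp
      have "s $ e m < 1"
      proof (rule ccontr)
        assume "\<not> s $ e m < 1"
        then have "\<gamma>' (s $ e m) = b" "s $ e m > 0"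
          using \<gamma> by (auto simp: \<gamma>'_def pathfinish_def)
        then show False
          using eqm b t by (smt (verit) mult_nonneg_nonneg mult_pos_pos)
      qed
      moreover have "s $ e m > -1"
      proof (rule ccontr)
        assume "\<not> s $ e m > -1"
        then have "\<gamma>' (s $ e m) = a" "s $ e m < 0"
          using \<gamma> by (auto simp: \<gamma>'_def pathstart_def)
        then show False
          using eqm a t by (smt (verit) mult_nonneg_nonpos mult_pos_neg)
      qed
      ultimately show ?thesis
        by auto
    qed
    then show "\<forall>s. \<forall>t\<in>{0..1}. (\<forall>i\<in>{1..m}. (1 - t) * (g i (\<delta> s) - c i) + t * s $ e i = 0) \<longrightarrow>
       (\<forall>i\<in>?I. s $ e i = 0) \<and> \<bar>s $ e m\<bar> < 1"
      by auto
  qed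
qed

section \<open>The equivariant system and the contradiction\<close>

theorem theorem2:
  fixes g :: "nat \<Rightarrow> real^'n \<Rightarrow> real" and c :: "nat \<Rightarrow> real" and m :: nat
    and Y X :: "(real^'n) set"
  assumes "2 \<le> m" and "m < CARD('n)"
    and "\<forall>i\<in>{1..m}. smooth_fun (g i)"
    and Y_def: "Y = {p. \<forall>i\<in>{1..m-1}. g i p = c i}"
    and X_def: "X = {p \<in> Y. g m p = c m}"
    and "bounded Y" and "connected Y"
    and "\<forall>p\<in>Y. lin_indep_family (\<lambda>i. grad (g i) p) {1..m-1}"
    and "finite (critical_values g m Y)"
    and "X \<noteq> {}"
    and "social_choice_solvable X"
  shows "(\<forall>y\<in>Y. g m y \<le> c m) \<or> (\<forall>y\<in>Y. c m \<le> g m y)"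
proof (rule ccontr)
  assume "\<not> ?thesis"
  then obtain a0 b0 where ab: "a0 \<in> Y" "g m a0 < c m" "b0 \<in> Y" "c m < g m b0"
    by (auto simp: not_le)
  have smooth: "smooth_fun (g i)" if "i \<in> {1..m}" for i
    using that assms(3) by blast
  obtain e :: "nat \<Rightarrow> 'n" where e: "bij_betw e {1..CARD('n)} UNIV"
    using ex_bij_betw_nat_finite_1[of "UNIV :: 'n set"] by auto
  have inj: "inj_on e {1..CARD('n)}"
    using e by (rule bij_betw_imp_inj_on)
  have inj_m: "inj_on e {1..m}"
    using inj by (rule inj_on_subset) (use assms(2) in auto)
  have m1: "1 \<le> m"
    using assms(1) by simp
  have ind: "lin_indep_family (\<lambda>i. grad (g i) p) {1..m-1}" if "p \<in> Y" for p
    using assms(8) that by blast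
  obtain \<delta> :: "real^'n \<Rightarrow> real^'n" where cont_\<delta>: "continuous_on UNIV \<delta>"
    and cross: "\<forall>s. \<forall>t\<in>{0..1}. (\<forall>i\<in>{1..m}. (1 - t) * (g i (\<delta> s) - c i) + t * s $ e i = 0) \<longrightarrow>
       (\<forall>i\<in>{1..m-1}. s $ e i = 0) \<and> \<bar>s $ e m\<bar> < 1"
    by (rule crossing_cube_exists[where g = g and c = c and m = m and e = e and Y = Y and a = a0 and b = b0,
          OF m1 inj_m smooth Y_def assms(7) ind ab])
  \<comment> \<open>The coordinates in \<open>J\<close> carry the \<open>m\<close> equations.
    \<open>j0\<close> is outside \<open>J\<close> because \<open>m < CARD('n)\<close>; it becomes
    the output coordinate that vanishes identically.\<close>
  define J where "J = e ` {1..m}"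
  define j0 where "j0 = e CARD('n)"
  have j0: "j0 \<notin> J"
  proof
    assume "j0 \<in> J"
    then obtain i where "i \<in> {1..m}" "e CARD('n) = e i"
      by (auto simp: J_def j0_def)
    then show False
      using inj assms(2) by (auto dest: inj_onD)
  qed
  define \<iota> where "\<iota> = the_inv_into {1..CARD('n)} e"
  have \<iota>: "\<iota> (e i) = i" if "i \<in> {1..m}" for i
    unfolding \<iota>_def using that assms(2) by (intro the_inv_into_f_f inj) auto
  define G where "G j x = g (\<iota> j) x - c (\<iota> j)" for j x
  have Ge: "G (e i) x = g i x - c i" if "i \<in> {1..m}" for i x
    using \<iota>[OF that] by (simp add: G_def)
  have cont_G: "continuous_on S (G j)" if j: "j \<in> J" for j S
  proof -
    obtain i where i: "i \<in> {1..m}" "j = e i"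
      using j by (auto simp: J_def)
    have "continuous_on S (\<lambda>x. g i x - c i)"
      by (intro continuous_on_diff continuous_on_const smooth_fun_continuous_on smooth i)
    moreover have "G j = (\<lambda>x. g i x - c i)"
      using Ge i by auto
    ultimately show ?thesis
      by simp
  qed
  have X_iff: "x \<in> X \<longleftrightarrow> (\<forall>j\<in>J. G j x = 0)" for x
  proof -
    have "{1..m} = insert m {1..m-1}"
      using assms(1) by auto
    then have "x \<in> X \<longleftrightarrow> (\<forall>i\<in>{1..m}. g i x = c i)"
      by (auto simp: X_def Y_def)
    also have "\<dots> \<longleftrightarrow> (\<forall>j\<in>J. G j x = 0)"
      by (auto simp: J_def Ge)
    finally show ?thesis .
  qed
  have "X = (\<Inter>j\<in>J. {x. G j x = 0})"
    using X_iff by auto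
  then have "closed X"
    using cont_G by (auto intro!: closed_INT closed_Collect_eq)
  moreover obtain F where "is_SCF 2 X F"
    using assms(11) by (auto simp: social_choice_solvable_def)
  ultimately obtain C where C0: "continuous_on UNIV C" "\<forall>x y. C (x, y) = C (y, x)"
    "\<forall>x\<in>X. \<forall>y\<in>X. C (x, y) \<in> X" "\<forall>x\<in>X. C (x, x) = x"
    by (rule two_agent_SCF_symmetric_extension)
  have C: "continuous_on UNIV C" "C (x, y) = C (y, x)"
    "x \<in> X \<Longrightarrow> y \<in> X \<Longrightarrow> C (x, y) \<in> X" "x \<in> X \<Longrightarrow> C (x, x) = x" for x y
    using C0 by blast+
  have "bounded X"
    using assms(6) by (rule bounded_subset) (auto simp: X_def)
  then obtain BX where BX: "BX > 0" "\<And>x. x \<in> X \<Longrightarrow> norm x \<le> BX"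
    by (auto simp: bounded_pos)
  have "bounded (\<delta> ` cball 0 1)"
    using continuous_on_subset[OF cont_\<delta>]
    by (intro compact_imp_bounded compact_continuous_image) auto
  then obtain BD where BD: "BD > 0" "\<And>s. norm s \<le> 1 \<Longrightarrow> norm (\<delta> s) \<le> BD"
    by (auto simp: bounded_pos)
  \<comment> \<open>\<open>R\<close> exceeds the bound \<open>2 * BX + 1\<close> for zeros of the
    whole system and the bounds \<open>BX + 1\<close> and \<open>BD + 1\<close> for zeros along the
    homotopies below.\<close>
  define R where "R = 2 * BX + BD + 2"
  have R: "R > 0"
    using BX BD by (simp add: R_def)
  have small: "norm s \<le> 1"
    if t: "0 \<le> t" "t \<le> 1" and eq: "\<And>j. j \<in> J \<Longrightarrow> (1 - t) * G j (\<delta> s) + t * s $ j = 0"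
      and s: "\<And>j. j \<notin> J \<Longrightarrow> s $ j = 0" for s t
  proof -
    have "\<forall>i\<in>{1..m}. (1 - t) * (g i (\<delta> s) - c i) + t * s $ e i = 0"
    proof
      fix i assume "i \<in> {1..m}"
      then show "(1 - t) * (g i (\<delta> s) - c i) + t * s $ e i = 0"
        using eq[of "e i"] Ge[of i] by (auto simp: J_def)
    qed
    then have cr: "\<forall>i\<in>{1..m-1}. s $ e i = 0" "\<bar>s $ e m\<bar> < 1"
      using bspec[OF spec[OF cross, of s], of t] t by (simp_all del: One_nat_def)
    have "s $ j = 0" if "j \<noteq> e m" for j
    proof (cases "j \<in> J")
      case True
      then obtain i where i: "i \<in> {1..m}" "j = e i"
        by (auto simp: J_def)
      with that have "i \<noteq> m"
        by auto
      with i cr(1) show ?thesis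
        by auto
    qed (rule s)
    then have "(\<Sum>j\<in>UNIV. \<bar>s $ j\<bar>) = (\<Sum>j\<in>{e m}. \<bar>s $ j\<bar>)"
      by (intro sum.mono_neutral_right) auto
    then show ?thesis
      using cr(2) norm_le_l1_cart[of s] by simp
  qed
  have small0: "norm s \<le> 1" if "\<delta> s \<in> X" "\<And>j. j \<notin> J \<Longrightarrow> s $ j = 0" for s
    using small[of 0 s] that X_iff by simp
  \<comment> \<open>The coordinates of \<open>s\<close> outside \<open>J\<close> fill up the
    equations to a vector: \<open>Q x s = 0\<close> means that \<open>x\<close> is in
    \<open>X\<close> and \<open>s\<close> is supported in \<open>J\<close>.\<close>
  define Q where "Q x s = (\<chi> j. if j \<in> J then G j x else s $ j)" for x s
  \<comment> \<open>On \<open>J\<close> the even output averages the equations at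
    \<open>a + b\<close> and \<open>a - b\<close>, and the odd output halves their difference, so a
    zero puts both points in \<open>X\<close>. The factor 1/2 leaves \<open>Q a s\<close> at
    \<open>b = 0\<close>.\<close>
  define \<Psi> :: "((real^'n) \<times> (real^'n)) \<times> (real^'n) \<Rightarrow> ((real^'n) \<times> (real^'n)) \<times> (real^'n)" where
    "\<Psi> = (\<lambda>((a, s), b). ((C (a + b, a - b) - \<delta> s, (1/2) *\<^sub>R (Q (a + b) s + Q (a - b) s)),
       (\<chi> j. if j \<in> J then (G j (a + b) - G j (a - b)) / 2 else if j = j0 then 0 else b $ j)))"
  have cont_Q: "continuous_on S (\<lambda>z. Q (f z) (h z))" if "continuous_on S f" "continuous_on S h"
    for S :: "'z::topological_space set" and f h
  proof -
    have "continuous_on S (\<lambda>z. if j \<in> J then G j (f z) else h z $ j)" for j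
      using that by (cases "j \<in> J")
        (auto intro!: continuous_intros continuous_on_compose2[OF cont_G[of _ UNIV]])
    then show ?thesis
      unfolding Q_def by (rule continuous_on_vec_lambda)
  qed
  have cont_\<delta>': "continuous_on S (\<lambda>z. \<delta> (f z))" if "continuous_on S f" for S :: "'z::topological_space set" and f
    using continuous_on_compose2[OF cont_\<delta> that] by simp
  have cont_C: "continuous_on S (\<lambda>z. C (f z))" if "continuous_on S f" for S :: "'z::topological_space set" and f
    using continuous_on_compose2[OF C(1) that] by simp
  have norm2: "norm (a, s) \<le> norm a + norm s" for a s :: "real^'n"
    by (simp add: norm_Pair sqrt_sum_squares_le_sum)
  obtain z where z: "norm z = R" "\<Psi> z = 0"
  proof (rule equivariant_map_has_zero_on_sphere[of "axis j0 1" R \<Psi>])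
    show "2 \<le> DIM((real^'n) \<times> (real^'n))" "2 \<le> DIM(real^'n)"
      using assms(1,2) by simp_all
    show "axis j0 1 \<in> (Basis :: (real^'n) set)"
      by (simp add: axis_in_Basis_iff)
    have "continuous_on UNIV (\<lambda>z :: ((real^'n) \<times> (real^'n)) \<times> (real^'n).
        if j \<in> J then (G j (fst (fst z) + snd z) - G j (fst (fst z) - snd z)) / 2 else if j = j0 then 0 else snd z $ j)" for j
      by (cases "j \<in> J"; cases "j = j0")
        (auto intro!: continuous_intros continuous_on_compose2[OF cont_G[of _ UNIV]])
    then show "continuous_on UNIV \<Psi>"
      unfolding \<Psi>_def case_prod_unfold
      by (intro continuous_intros cont_Q cont_\<delta>' cont_C continuous_on_vec_lambda)
    show "\<Psi> (p, - b) = (fst (\<Psi> (p, b)), - snd (\<Psi> (p, b)))" for p b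
      using C(2) by (auto simp: \<Psi>_def case_prod_unfold vec_eq_iff add.commute field_simps)
    show "snd (\<Psi> p) \<bullet> axis j0 1 = 0" for p
      using j0 by (simp add: \<Psi>_def case_prod_unfold inner_axis)
    \<comment> \<open>Stages from the fixed-space part \<open>f0\<close> to the identity: replace
      \<open>C (a, a)\<close> by \<open>a\<close>, then \<open>Q a s\<close> by
      \<open>Q (\<delta> s) s\<close>, then this by \<open>s\<close>, and finally remove
      \<open>\<delta> s\<close>. Each stage is a straight-line homotopy with zeros only inside the
      sphere.\<close>
    define f0 f1 f2 f3 :: "(real^'n) \<times> (real^'n) \<Rightarrow> (real^'n) \<times> (real^'n)"
      where "f0 z = (C (fst z, fst z) - \<delta> (snd z), Q (fst z) (snd z))"
        and "f1 z = (fst z - \<delta> (snd z), Q (fst z) (snd z))"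
        and "f2 z = (fst z - \<delta> (snd z), Q (\<delta> (snd z)) (snd z))"
        and "f3 z = (fst z - \<delta> (snd z), snd z)" for z
    have lin: "homotopic_with_canon (\<lambda>_. True) (sphere 0 R) (- {0}) f h"
      if "continuous_on (sphere 0 R) f" "continuous_on (sphere 0 R) h"
        and bd: "\<And>a s t. 0 \<le> t \<Longrightarrow> t \<le> 1 \<Longrightarrow> (1 - t) *\<^sub>R f (a, s) + t *\<^sub>R h (a, s) = 0 \<Longrightarrow> norm a + norm s < R"
      for f h :: "(real^'n) \<times> (real^'n) \<Rightarrow> (real^'n) \<times> (real^'n)"
    proof (rule homotopic_with_linear[OF that(1,2)])
      fix z :: "(real^'n) \<times> (real^'n)" assume "z \<in> sphere 0 R"
      then have "norm (fst z) + norm (snd z) \<ge> R"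
        using norm2[of "fst z" "snd z"] by simp
      then show "closed_segment (f z) (h z) \<subseteq> - {0}"
        using bd[of _ "fst z" "snd z"] by (force simp: closed_segment_def)
    qed
    have c0: "continuous_on S f0" and c1: "continuous_on S f1" and c2: "continuous_on S f2"
      and c3: "continuous_on S f3" for S
      unfolding f0_def f1_def f2_def f3_def by (intro continuous_intros cont_Q cont_\<delta>' cont_C)+
    \<comment> \<open>The second component stays \<open>Q a s\<close>; its vanishing puts
      \<open>a\<close> in \<open>X\<close>, where unanimity makes both first components
      agree.\<close>
    have h01: "homotopic_with_canon (\<lambda>_. True) (sphere 0 R) (- {0}) f0 f1"
    proof (rule lin[OF c0 c1])
      fix a s :: "real^'n" and t :: real
      assume "(1 - t) *\<^sub>R f0 (a, s) + t *\<^sub>R f1 (a, s) = 0"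
      then have eq: "(1 - t) *\<^sub>R (C (a, a) - \<delta> s) + t *\<^sub>R (a - \<delta> s) = 0" and Q: "Q a s = 0"
        by (simp_all add: f0_def f1_def zero_prod_def)
      have a: "a \<in> X" and s: "\<And>j. j \<notin> J \<Longrightarrow> s $ j = 0"
        using Q by (auto simp: Q_def vec_eq_iff X_iff split: if_splits)
      have "\<delta> s = a"
        using eq C(4)[OF a] by simp
      then show "norm a + norm s < R"
        using a small0[OF _ s] BX BD by (fastforce simp: R_def)
    qed
    \<comment> \<open>The unchanged first component forces \<open>a = \<delta> s\<close>, which
      makes the two second components equal.\<close>
    have h12: "homotopic_with_canon (\<lambda>_. True) (sphere 0 R) (- {0}) f1 f2"
    proof (rule lin[OF c1 c2])
      fix a s :: "real^'n" and t :: real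
      assume eq: "(1 - t) *\<^sub>R f1 (a, s) + t *\<^sub>R f2 (a, s) = 0"
      have a: "a = \<delta> s" and Q: "(1 - t) *\<^sub>R Q a s + t *\<^sub>R Q (\<delta> s) s = 0"
        using arg_cong[OF eq, of fst] arg_cong[OF eq, of snd] by (simp_all add: f1_def f2_def)
      from Q have "Q a s = 0"
        by (simp flip: a)
      then have aX: "a \<in> X" and s: "\<And>j. j \<notin> J \<Longrightarrow> s $ j = 0"
        by (auto simp: Q_def vec_eq_iff X_iff split: if_splits)
      then show "norm a + norm s < R"
        using a small0[OF _ s] BX BD by (fastforce simp: R_def)
    qed
    \<comment> \<open>This stage needs the crossing property for every \<open>t\<close>: through
      \<open>small\<close> it confines \<open>s\<close> to the unit ball.\<close>
    have h23: "homotopic_with_canon (\<lambda>_. True) (sphere 0 R) (- {0}) f2 f3"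
    proof (rule lin[OF c2 c3])
      fix a s :: "real^'n" and t :: real
      assume t: "0 \<le> t" "t \<le> 1" and "(1 - t) *\<^sub>R f2 (a, s) + t *\<^sub>R f3 (a, s) = 0"
      then have a: "a = \<delta> s" and Q: "(1 - t) *\<^sub>R Q (\<delta> s) s + t *\<^sub>R s = 0"
        by (simp_all add: f2_def f3_def zero_prod_def)
      have Qj: "(1 - t) * (if j \<in> J then G j (\<delta> s) else s $ j) + t * s $ j = 0" for j
        using arg_cong[OF Q, of "\<lambda>v. v $ j"] by (simp add: Q_def)
      have "norm s \<le> 1"
      proof (rule small[OF t])
        show "(1 - t) * G j (\<delta> s) + t * s $ j = 0" if "j \<in> J" for j
          using Qj[of j] that by simp
        show "s $ j = 0" if "j \<notin> J" for j
          using Qj[of j] that by (simp add: algebra_simps)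
      qed
      then show "norm a + norm s < R"
        using a BD BX by (fastforce simp: R_def)
    qed
    have h34: "homotopic_with_canon (\<lambda>_. True) (sphere 0 R) (- {0}) f3 id"
    proof (rule lin[OF c3 continuous_on_id'])
      fix a s :: "real^'n" and t :: real
      assume t: "0 \<le> t" "t \<le> 1" and eq: "(1 - t) *\<^sub>R f3 (a, s) + t *\<^sub>R id (a, s) = 0"
      have s: "s = 0"
        using arg_cong[OF eq, of snd] by (simp add: f3_def)
      have "a = (1 - t) *\<^sub>R \<delta> 0"
        using arg_cong[OF eq, of fst] s by (simp add: f3_def algebra_simps)
      then have "norm a \<le> norm (\<delta> 0)"
        using t by (simp add: mult_left_le_one_le)
      then show "norm a + norm s < R"
        using s BD(2)[of 0] BX BD(1) by (simp add: R_def)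
    qed
    have "(\<lambda>p. fst (\<Psi> (p, 0))) = f0"
      by (auto simp: \<Psi>_def f0_def case_prod_unfold simp flip: scaleR_2)
    then show "homotopic_with_canon (\<lambda>_. True) (sphere 0 R) (- {0}) (\<lambda>p. fst (\<Psi> (p, 0))) id"
      using homotopic_with_trans[OF h01 homotopic_with_trans[OF h12 homotopic_with_trans[OF h23 h34]]]
      by simp
  qed (use R in auto)
  obtain a s b where zz: "z = ((a, s), b)"
    by (metis prod.exhaust)
  let ?x = "a + b" and ?y = "a - b"
  have eqs: "C (?x, ?y) = \<delta> s" "Q ?x s + Q ?y s = 0"
    using z(2) by (auto simp: zz \<Psi>_def zero_prod_def)
  \<comment> \<open>The odd outputs make the two values equal and the even ones make their sum zero,
    so both vanish.\<close>
  have odd: "G j ?x = G j ?y" if "j \<in> J" for j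
    using arg_cong[OF z(2), of "\<lambda>v. snd v $ j"] that by (simp add: zz \<Psi>_def)
  have Qj: "(if j \<in> J then G j ?x else s $ j) + (if j \<in> J then G j ?y else s $ j) = 0" for j
    using arg_cong[OF eqs(2), of "\<lambda>v. v $ j"] by (simp add: Q_def)
  have "G j ?x = 0 \<and> G j ?y = 0" if "j \<in> J" for j
    using Qj[of j] odd[OF that] that by simp
  then have xy: "?x \<in> X" "?y \<in> X"
    by (simp_all add: X_iff)
  have s: "s $ j = 0" if "j \<notin> J" for j
    using Qj[of j] that by simp
  have "norm s \<le> 1"
    using small0[OF _ s] C(3)[OF xy] eqs(1) by simp
  moreover have "norm a \<le> BX"
  proof -
    have "a = (1/2) *\<^sub>R (?x + ?y)"
      by (simp flip: scaleR_2)
    then have "norm a \<le> (1/2) * (norm ?x + norm ?y)"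
      by (metis norm_scaleR norm_triangle_ineq abs_of_nonneg mult_left_mono zero_le_divide_1_iff zero_le_numeral)
    then show ?thesis
      using BX(2)[OF xy(1)] BX(2)[OF xy(2)] by simp
  qed
  moreover have "norm b \<le> BX"
  proof -
    have "b = (1/2) *\<^sub>R (?x - ?y)"
      by (simp flip: scaleR_2)
    then have "norm b \<le> (1/2) * (norm ?x + norm ?y)"
      by (metis norm_scaleR norm_triangle_ineq4 abs_of_nonneg mult_left_mono zero_le_divide_1_iff zero_le_numeral)
    then show ?thesis
      using BX(2)[OF xy(1)] BX(2)[OF xy(2)] by simp
  qed
  moreover have "norm z \<le> norm a + norm s + norm b"
  proof -
    have "norm z \<le> norm (a, s) + norm b"
      by (simp add: zz norm_Pair[of "(a, s)" b] sqrt_sum_squares_le_sum)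
    with norm2[of a s] show ?thesis by simp
  qed
  ultimately show False
    using z(1) BX(1) BD(1) by (simp add: R_def)
qed

end
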